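(* Let $\mathbb{K} = \mathbb{R}$ or $\mathbb{C}$, let $1 \le d \le n$ be integers, and let $\vec{r} = (r_1,\dots,r_n) \in \mathbb{Q}_+^n$ be admissible. Let $E_{\vec{r}} : \mathbb{K}^{d\times n} \to \mathbb{R}$ be the total frame energy, and let $\Gamma_{\vec{r}} : \mathbb{K}^{d\times n}\times[0,\infty) \to \mathbb{K}^{d\times n}$ be its negative gradient flow, defined by $$\Gamma_{\vec{r}}(F_0,0) = F_0, \qquad \frac{d}{dt}\Gamma_{\vec{r}}(F_0,t) = -\nabla E_{\vec{r}}(\Gamma_{\vec{r}}(F_0,t)).$$ If $F_0 \in \mathbb{K}^{d\times n}$ is full spark, then $\lim_{t\to\infty}\Gamma_{\vec{r}}(F_0,t)$ is an element of $\mathrm{PF}_d(\vec{r})$.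
   Context: For $F = [f_1 \ \cdots\ f_n] \in \mathbb{K}^{d\times n}$ with columns $f_i$, $F^*$ is the (conjugate) transpose. For $\vec{r}$ with positive entries, the total frame energy is $$E_{\vec{r}}(F) = \|FF^* - \mathbb{I}_d\|_{\mathrm{Fr}}^2 + \frac14 \sum_{i=1}^n\left(\frac{\|f_i\|^2}{r_i}-1\right)^2,$$ with $\|\cdot\|_{\mathrm{Fr}}$ the Frobenius norm. The gradient is taken with respect to the real inner product $\langle X,Y\rangle = \operatorname{Re}\operatorname{tr}(X^*Y)$ on $\mathbb{K}^{d\times n}$ regarded as a real vector space. $\mathrm{PF}_d(\vec{r})$ is the set of $F \in \mathbb{K}^{d\times n}$ with $FF^* = \mathbb{I}_d$ and $\|f_i\|^2 = r_i$ for all $i$ (Parseval frames with prescribed squared norms). $\vec{r}$ is admissible if $\sum_{i=1}^n r_i = d$ and $\sum_{i=1}^k r_{(i)} \le k$ for all $1\le k\le d-1$, where $r_{(1)}\ge\dots\ge r_{(n)}>0$ is the decreasing rearrangement of $(r_1,\dots,r_n)$. $F\in\mathbb{K}^{d\times n}$ is full spark if every $d\times d$ submatrix formed by $d$ of its columns is nonsingular. *)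

theory Defs
  imports "HOL-Analysis.Analysis" "Jordan_Normal_Form.Conjugate"
begin

text \<open>
  A \<open>d \<times> n\<close> matrix over \<open>\<bbbK>\<close> is an element of \<^typ>\<open>'k^'n^'d\<close>, with \<open>d = CARD('d)\<close> and
  \<open>n = CARD('n)\<close>. The definitions are only meant for \<open>'k = real\<close> and \<open>'k = complex\<close>; for these,
  \<^const>\<open>conjugate\<close> is the identity and \<^const>\<open>cnj\<close>, respectively, and the library norm on
  \<^typ>\<open>'k^'n^'d\<close> is the Frobenius norm.
\<close>

definition adjoint_matrix :: "'k::conjugatable_ring^'n^'d \<Rightarrow> 'k^'d^'n" where
  "adjoint_matrix F = (\<chi> j i. conjugate (F $ i $ j))"

definition total_frame_energy ::
    "real^'n \<Rightarrow> 'k::{conjugatable_field, real_normed_field}^'n^'d \<Rightarrow> real" where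
  "total_frame_energy r F =
     (norm (F ** adjoint_matrix F - mat 1))\<^sup>2
     + 1 / 4 * (\<Sum>i\<in>UNIV. ((norm (column i F))\<^sup>2 / r $ i - 1)\<^sup>2)"

definition parseval_frames ::
    "real^'n \<Rightarrow> ('k::{conjugatable_field, real_normed_field}^'n^'d) set" where
  "parseval_frames r =
     {F. F ** adjoint_matrix F = mat 1 \<and> (\<forall>i. (norm (column i F))\<^sup>2 = r $ i)}"

text \<open>The \<open>k\<close>-th largest entry of \<open>r\<close> is \<open>decreasing_rearrangement r ! (k - 1)\<close>.\<close>

definition decreasing_rearrangement :: "real^'n \<Rightarrow> real list" where
  "decreasing_rearrangement r =
     rev (sorted_list_of_multiset (image_mset (\<lambda>i. r $ i) (mset_set UNIV)))"

definition admissible :: "nat \<Rightarrow> real^'n \<Rightarrow> bool" where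
  "admissible d r \<longleftrightarrow>
     (\<forall>i. 0 < r $ i) \<and>
     (\<Sum>i\<in>UNIV. r $ i) = real d \<and>
     (\<forall>k\<in>{1..d - 1}. (\<Sum>i=1..k. decreasing_rearrangement r ! (i - 1)) \<le> real k)"

text \<open>A choice of \<open>d\<close> distinct columns, in some order, is an injective map into \<open>'n\<close>.\<close>

definition full_spark :: "'k::field^'n^'d \<Rightarrow> bool" where
  "full_spark F \<longleftrightarrow>
     (\<forall>c :: 'd \<Rightarrow> 'n. inj c \<longrightarrow> invertible (\<chi> i j. F $ i $ c j))"

text \<open>
  The gradient with respect to the library inner product; on \<^typ>\<open>'k^'n^'d\<close> this is
  \<open>Re (tr (X\<^sup>* Y))\<close>, see \<open>inner_matrix_real\<close> and \<open>inner_matrix_complex\<close> below.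
\<close>

definition gradient :: "('a::real_inner \<Rightarrow> real) \<Rightarrow> 'a \<Rightarrow> 'a" where
  "gradient f x = (THE D. GDERIV f x :> D)"

definition is_negative_gradient_flow ::
    "('a::real_inner \<Rightarrow> real) \<Rightarrow> ('a \<Rightarrow> real \<Rightarrow> 'a) \<Rightarrow> bool" where
  "is_negative_gradient_flow f \<Gamma> \<longleftrightarrow>
     (\<forall>x. \<Gamma> x 0 = x \<and>
        (\<forall>t\<ge>0. (\<Gamma> x has_vector_derivative - gradient f (\<Gamma> x t)) (at t within {0..})))"

lemma inner_matrix_real:
  fixes X Y :: "real^'n^'d"
  shows "X \<bullet> Y = trace (adjoint_matrix X ** Y)"
proof -
  have "X \<bullet> Y = (\<Sum>i\<in>UNIV. \<Sum>j\<in>UNIV. X $ i $ j * Y $ i $ j)"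
    by (simp add: inner_vec_def)
  then show ?thesis
    by (subst (asm) sum.swap)
      (simp add: trace_def adjoint_matrix_def matrix_matrix_mult_def)
qed

lemma inner_matrix_complex:
  fixes X Y :: "complex^'n^'d"
  shows "X \<bullet> Y = Re (trace (adjoint_matrix X ** Y))"
proof -
  have "X \<bullet> Y = (\<Sum>i\<in>UNIV. \<Sum>j\<in>UNIV. Re (cnj (X $ i $ j) * Y $ i $ j))"
    by (simp add: inner_vec_def inner_complex_def)
  then show ?thesis
    by (subst (asm) sum.swap)
      (simp add: trace_def adjoint_matrix_def matrix_matrix_mult_def)
qed

lemma gradient_eqI:
  assumes "GDERIV f x :> D"
  shows "gradient f x = D"
  unfolding gradient_def
proof (rule the_equality)
  fix D' assume "GDERIV f x :> D'"
  with assms have "(\<lambda>h. h \<bullet> D) = (\<lambda>h. h \<bullet> D')"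
    unfolding gderiv_def by (rule has_derivative_unique)
  then have "(D' - D) \<bullet> D = (D' - D) \<bullet> D'"
    by (rule fun_cong)
  then have "(D' - D) \<bullet> (D' - D) = 0"
    by (simp add: inner_diff_right)
  then show "D' = D"
    by simp
qed (fact assms)

lemma total_frame_energy_has_gradient:
  fixes r :: "real^'n"
    and F :: "'k::{conjugatable_field, real_normed_field, euclidean_space}^'n^'d"
  assumes "linear (conjugate :: 'k \<Rightarrow> 'k)"
  shows "\<exists>D. GDERIV (total_frame_energy r) F :> D"
proof -
  have norm_sq: "(\<lambda>x. (norm (g x))\<^sup>2) differentiable at F"
    if "g differentiable at F" for g :: "'k^'n^'d \<Rightarrow> 'v::real_inner"
    using that unfolding power2_norm_eq_inner differentiable_def
    by (blast intro: has_derivative_inner)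
  have "linear (adjoint_matrix :: 'k^'n^'d \<Rightarrow> 'k^'d^'n)"
    by (rule linearI)
      (simp_all add: adjoint_matrix_def vec_eq_iff linear_add[OF assms] linear_scale[OF assms])
  then have adj: "(adjoint_matrix :: 'k^'n^'d \<Rightarrow> 'k^'d^'n) differentiable at F"
    by (simp add: linear_imp_differentiable)
  have "bilinear ((**) :: 'k^'n^'d \<Rightarrow> 'k^'d^'n \<Rightarrow> 'k^'d^'d)"
    by (auto simp: bilinear_def vec_eq_iff matrix_matrix_mult_def sum.distrib algebra_simps
        scaleR_sum_right intro!: linearI)
  then have "bounded_bilinear ((**) :: 'k^'n^'d \<Rightarrow> 'k^'d^'n \<Rightarrow> 'k^'d^'d)"
    by (simp add: bilinear_conv_bounded_bilinear)
  from bounded_bilinear.FDERIV[OF this has_derivative_ident] adj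
  have "(\<lambda>F :: 'k^'n^'d. F ** adjoint_matrix F) differentiable at F"
    unfolding differentiable_def by blast
  then have gram: "(\<lambda>F :: 'k^'n^'d. (norm (F ** adjoint_matrix F - mat 1))\<^sup>2) differentiable at F"
    by (intro norm_sq differentiable_diff) auto
  have "linear (column i :: 'k^'n^'d \<Rightarrow> 'k^'d)" for i
    by (rule linearI) (simp_all add: column_def vec_eq_iff)
  then have "(\<lambda>F :: 'k^'n^'d. (norm (column i F))\<^sup>2) differentiable at F" for i :: 'n
    by (intro norm_sq linear_imp_differentiable)
  then have "(\<lambda>F :: 'k^'n^'d. ((norm (column i F))\<^sup>2 / r $ i - 1)\<^sup>2) differentiable at F" for i
    unfolding divide_inverse
    by (rule differentiable_power[OF differentiable_diff[OF differentiable_mult]]) simp_all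
  with gram have "total_frame_energy r differentiable at F"
    unfolding total_frame_energy_def [abs_def]
    by (intro differentiable_add differentiable_mult differentiable_sum) auto
  then obtain f' where f': "(total_frame_energy r has_derivative f') (at F)"
    unfolding differentiable_def by blast
  then have "linear f'"
    by (rule has_derivative_linear)
  then have "f' = (\<lambda>h. h \<bullet> adjoint f' 1)"
    by (simp add: fun_eq_iff adjoint_works)
  with f' show ?thesis
    unfolding gderiv_def by metis
qed

lemma total_frame_energy_has_gradient_real:
  "\<exists>D. GDERIV (total_frame_energy r) (F :: real^'n^'d) :> D"
  by (rule total_frame_energy_has_gradient) (auto intro: linearI)

lemma total_frame_energy_has_gradient_complex:
  "\<exists>D. GDERIV (total_frame_energy r) (F :: complex^'n^'d) :> D"
  by (rule total_frame_energy_has_gradient) (auto intro: linearI)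

end

theory Submission
  imports Defs
begin

text \<open>
Write \<open>M = F F\<^sup>* - 1\<close> for the defect of the frame operator and
\<open>\<nu>\<^sub>i = (|f\<^sub>i|\<^sup>2 / r\<^sub>i - 1) / r\<^sub>i\<close> for the defects of the column norms. Then
\<open>E = |M|\<^sup>2 + 1/4 \<Sum>\<^sub>i (r\<^sub>i \<nu>\<^sub>i)\<^sup>2\<close>, and the flow reads \<open>f\<^sub>i' = - 4 M f\<^sub>i - \<nu>\<^sub>i f\<^sub>i\<close>. The proof has two
independent halves: the energy of the flow tends to \<open>0\<close>, and a flow line whose energy tends to \<open>0\<close>
has finite length.

\<^emph>\<open>The energy tends to zero.\<close> The equation says that \<open>f\<^sub>i(t)\<close> is \<open>exp (y\<^sub>i(t)) A(t) f\<^sub>i(0)\<close>, where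
\<open>y\<^sub>i' = - \<nu>\<^sub>i\<close> and \<open>A' = - 4 M A\<close>: the flow stays in an orbit of invertible row operations and
positive column scalings. Here \<open>|det A| = exp a\<close> with \<open>a' = - 4 tr M\<close>. Along the flow the Kempf-Ness
function of this group action, \<open>\<psi> = |F|\<^sup>2 / 2 - a - \<Sum>\<^sub>i r\<^sub>i y\<^sub>i\<close>, has derivative exactly \<open>- 4 E\<close>. As \<open>E\<close> is
nonincreasing, \<open>\<psi> + 4 t E\<close> is nonincreasing too, so that \<open>E \<le> const / t\<close> as soon as \<open>\<psi>\<close> is bounded
below. This is where full spark and admissibility enter. For every choice \<open>c\<close> of \<open>d\<close> columns, Leibniz'
formula bounds the nonzero number \<open>det F\<^sub>c(0)\<close> times \<open>exp a\<close> by a constant times the product of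
\<open>exp (- y\<^sub>i) |f\<^sub>i|\<close> over \<open>i\<close> in \<open>c\<close>; in logarithms, \<open>a - const \<le> \<Sum>\<^sub>c \<beta>\<^sub>i\<close> for \<open>\<beta>\<^sub>i = ln |f\<^sub>i| - y\<^sub>i\<close>. Admissibility
gives \<open>0 < r\<^sub>i \<le> 1\<close> and \<open>\<Sum>\<^sub>i r\<^sub>i = d\<close>, and under these constraints \<open>\<Sum>\<^sub>i r\<^sub>i \<beta>\<^sub>i\<close> is at least the sum of the \<open>d\<close>
smallest \<open>\<beta>\<^sub>i\<close>. Together with \<open>r\<^sub>i ln |f\<^sub>i| \<le> |f\<^sub>i|\<^sup>2 / 2\<close> this bounds \<open>\<psi>\<close> from below
(\<open>kempf_ness_lower_bound\<close>, \<open>energy_tendsto_0\<close>).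

\<^emph>\<open>Finite length.\<close> At Parseval frames that split into orthogonal pieces, the energy may vanish to fourth
order in directions that leave the set of Parseval frames, and convergence need not be exponential. But
\<open>|grad E|\<^sup>4 \<ge> const E\<^sup>3\<close> holds wherever \<open>E\<close> is small (\<open>total_frame_energy_Lojasiewicz\<close>), and then
\<open>- (E powr (1/4))'\<close> dominates the speed \<open>|grad E|\<close>. To see the inequality, take an eigenbasis of \<open>M\<close> with
eigenvalues \<open>\<mu>\<^sub>b\<close> and let \<open>p\<close> be the matrix of the numbers \<open>|\<langle>b, f\<^sub>i\<rangle>|\<^sup>2\<close>. Its row sums are \<open>1 + \<mu>\<^sub>b\<close>, its column
sums are \<open>r\<^sub>i + r\<^sub>i\<^sup>2 \<nu>\<^sub>i\<close>, and \<open>|grad E|\<^sup>2\<close> is the sum of the \<open>p\<^sub>b\<^sub>i (4 \<mu>\<^sub>b + \<nu>\<^sub>i)\<^sup>2\<close>. So nothing but a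
combinatorial estimate on nonnegative matrices with nearly prescribed marginals is left
(\<open>perturbed_plan_cost\<close>).

Once the limit exists, continuity of \<open>E\<close> makes it a zero of \<open>E\<close>, which is a Parseval frame with the
prescribed norms. The analysis is done over the complex numbers; a real flow line is also a complex one,
since the gradients agree on real matrices.
\<close>

section \<open>Transport plans with perturbed marginals\<close>

text \<open>
The half-open interval \<open>[0, \<delta>)\<close> has \<open>N\<close> cells of length \<open>\<delta> / N\<close>. As \<open>\<delta>\<close> itself lies in none of them,
fewer than \<open>N\<close> points are left for them, and some cell is free.
\<close>

lemma finite_set_has_gap_below:
  fixes V :: "real set"
  assumes fin: "finite V" and card: "card V \<le> N" and \<delta>: "\<delta> \<in> V" "0 < \<delta>"
  obtains s where "0 \<le> s" "s + \<delta> / N \<le> \<delta>" "\<And>v. v \<in> V \<Longrightarrow> v < s \<or> s + \<delta> / N \<le> v"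
proof -
  have N: "0 < N"
    using assms by (metis card_gt_0_iff empty_iff le_zero_eq neq0_conv)
  define cell where "cell k = {k * \<delta> / N ..< (k + 1) * \<delta> / N}" for k :: nat
  have "\<exists>k<N. cell k \<inter> V = {}"
  proof (rule ccontr)
    assume "\<not> ?thesis"
    then have "\<forall>k\<in>{..<N}. \<exists>v. v \<in> cell k \<inter> V" by auto
    then obtain v where v: "\<And>k. k < N \<Longrightarrow> v k \<in> cell k \<inter> V"
      by (metis lessThan_iff)
    have below: "v k < \<delta>" if "k < N" for k
    proof -
      have "v k < (k + 1) * \<delta> / N" using v[OF that] by (simp add: cell_def)
      also have "\<dots> \<le> N * \<delta> / N" using that \<delta> N
        by (intro divide_right_mono mult_right_mono) auto
      finally show ?thesis using N by simp
    qed
    have less: "v j < v k" if "j < k" "k < N" for j k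
    proof -
      have "v j < (j + 1) * \<delta> / N" using v[of j] that by (simp add: cell_def)
      also have "\<dots> \<le> k * \<delta> / N" using that \<delta> N
        by (intro divide_right_mono mult_right_mono) auto
      also have "\<dots> \<le> v k" using v[of k] that by (simp add: cell_def)
      finally show ?thesis .
    qed
    have "inj_on v {..<N}"
      using less by (intro inj_onI) (metis lessThan_iff less_irrefl nat_neq_iff)
    moreover have "v ` {..<N} \<subseteq> V - {\<delta>}" using v below by fastforce
    ultimately have "N \<le> card (V - {\<delta>})"
      using fin by (metis card_image card_lessThan card_mono finite_Diff)
    then show False using card \<delta> fin N by (simp add: card_Diff_singleton)
  qed
  then obtain k where k: "k < N" "cell k \<inter> V = {}" by auto
  have step: "k * \<delta> / N + \<delta> / N = (k + 1) * \<delta> / N"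
    by (simp add: field_simps add_divide_distrib)
  have "(k + 1) * \<delta> / N \<le> N * \<delta> / N" using k \<delta> N
    by (intro divide_right_mono mult_right_mono) auto
  then have "(k + 1) * \<delta> / N \<le> \<delta>" using N by simp
  moreover have "v < k * \<delta> / N \<or> (k + 1) * \<delta> / N \<le> v" if "v \<in> V" for v
    using k(2) that unfolding cell_def by (metis IntI atLeastLessThan_iff empty_iff not_le)
  moreover have "0 \<le> k * \<delta> / N" using \<delta> by simp
  ultimately show ?thesis using that[of "k * \<delta> / N"] unfolding step by blast
qed

text \<open>
Finitely many candidate imbalances cannot come arbitrarily close to \<open>0\<close> without being \<open>0\<close>; this supplies
the threshold below which the perturbations of the marginals count as small.
\<close>

lemma finite_nonzero_abs_bounded_below:
  fixes G :: "real set"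
  assumes "finite G"
  obtains \<gamma> where "0 < \<gamma>" "\<And>g. g \<in> G \<Longrightarrow> g = 0 \<or> \<gamma> \<le> \<bar>g\<bar>"
proof (cases "G - {0} = {}")
  case True
  then show ?thesis using that[of 1] by auto
next
  case False
  let ?H = "abs ` (G - {0})"
  have fin: "finite ?H" using assms by auto
  show ?thesis
  proof (rule that[of "Min ?H"])
    show "0 < Min ?H" using fin False by (subst Min_gr_iff) auto
    show "g = 0 \<or> Min ?H \<le> \<bar>g\<bar>" if "g \<in> G" for g
      using fin that by (auto intro!: Min_le)
  qed
qed

text \<open>
A transport plan \<open>p\<close> between \<open>D\<close> unit masses and the masses \<open>v i\<close>, up to a perturbation of the marginals
that is linear in potentials \<open>x\<close> and \<open>y\<close>. The estimates below bound the cost \<open>\<Sum> p (x - y)\<^sup>2\<close> measured with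
the same potentials. The sign \<open>\<sigma>\<close> exists so that negating both potentials gives a perturbed plan again.
The factor \<open>1/4\<close> matches the coefficient \<open>4\<close> of the frame defect in the gradient of the energy.
\<close>

definition perturbed_plan ::
    "nat \<Rightarrow> ('i::finite \<Rightarrow> real) \<Rightarrow> ('i \<Rightarrow> real) \<Rightarrow> real \<Rightarrow> 'b set \<Rightarrow> ('b \<Rightarrow> 'i \<Rightarrow> real) \<Rightarrow>
     ('b \<Rightarrow> real) \<Rightarrow> ('i \<Rightarrow> real) \<Rightarrow> bool" where
  "perturbed_plan D v \<beta> \<sigma> B p x y \<longleftrightarrow>
     finite B \<and> card B = D \<and> (\<forall>b i. 0 \<le> p b i) \<and>
     (\<forall>b\<in>B. (\<Sum>i\<in>UNIV. p b i) = 1 + \<sigma> * x b / 4) \<and>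
     (\<forall>i. (\<Sum>b\<in>B. p b i) = v i - \<sigma> * (\<beta> i * y i))"

text \<open>
Cut the rows and columns at a gap of the potentials below their maximum \<open>\<delta>\<close>. Above the cut all potentials
are at least \<open>\<delta> / N\<close>, so their total effect \<open>T\<close> on the masses above the cut is at least of order \<open>\<delta>\<close>.
The unperturbed masses above the cut either balance exactly or are off by at least \<open>\<gamma>\<close>, which exceeds \<open>T\<close>
when \<open>\<delta>\<close> is small. In both cases mass of order \<open>\<delta>\<close> has to cross the cut, and each unit of it
costs at least the squared width \<open>(\<delta> / N)\<^sup>2\<close> of the gap: in total \<open>\<delta>\<^sup>3\<close>, not merely \<open>\<delta>\<^sup>4\<close>.
\<close>

lemma perturbed_plan_cost_one_sided:
  fixes v \<beta> :: "'i::finite \<Rightarrow> real" and D :: nat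
  assumes \<beta>: "\<And>i. 0 < \<beta> i"
  shows "\<exists>\<epsilon>>0. \<exists>c>0. \<forall>(B :: 'b set) p x y \<sigma> \<delta>.
       perturbed_plan D v \<beta> \<sigma> B p x y \<longrightarrow> \<bar>\<sigma>\<bar> = 1 \<longrightarrow> (\<forall>b\<in>B. x b \<le> \<delta>) \<longrightarrow> (\<forall>i. y i \<le> \<delta>) \<longrightarrow>
       ((\<exists>b\<in>B. x b = \<delta>) \<or> (\<exists>i. y i = \<delta>)) \<longrightarrow> 0 < \<delta> \<longrightarrow> \<delta> \<le> \<epsilon> \<longrightarrow>
       c * \<delta> ^ 3 \<le> (\<Sum>b\<in>B. \<Sum>i\<in>UNIV. p b i * (x b - y i)\<^sup>2)"
proof -
  define N where "N = D + CARD('i)"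
  have N: "0 < N" by (simp add: N_def)
  define \<kappa> where "\<kappa> = Min (insert (1/4) (range \<beta>))"
  have \<kappa>: "0 < \<kappa>" "\<kappa> \<le> 1/4" "\<And>i. \<kappa> \<le> \<beta> i"
    using \<beta> by (auto simp: \<kappa>_def min.coboundedI2)
  \<comment> \<open>The summand \<open>1\<close> only serves to make \<open>L\<close> positive, so that one can divide by it.\<close>
  define L where "L = D / 4 + sum \<beta> UNIV + 1"
  have "0 \<le> sum \<beta> UNIV" using \<beta> by (intro sum_nonneg) (simp add: less_imp_le)
  then have L: "0 < L" by (simp add: L_def add_nonneg_pos)
  \<comment> \<open>All imbalances between \<open>k\<close> unit masses and a set of columns.\<close>
  define G where "G = (\<lambda>(k::nat, C). real k - sum v C) ` ({..D} \<times> UNIV)"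
  have "finite G" by (simp add: G_def)
  then obtain \<gamma> where \<gamma>: "0 < \<gamma>" "\<And>g. g \<in> G \<Longrightarrow> g = 0 \<or> \<gamma> \<le> \<bar>g\<bar>"
    by (rule finite_nonzero_abs_bounded_below) auto
  show ?thesis
  proof (rule exI[of _ "\<gamma> / (2 * L)"], intro conjI, goal_cases)
    case 1
    show ?case using \<gamma> L by simp
  next
    case 2
    show ?case
    proof (rule exI[of _ "\<kappa> / N ^ 3"], intro conjI allI impI)
      show "0 < \<kappa> / N ^ 3" using \<kappa> N by auto
      fix B :: "'b set" and p :: "'b \<Rightarrow> 'i \<Rightarrow> real" and x y \<sigma> \<delta>
      assume plan: "perturbed_plan D v \<beta> \<sigma> B p x y" and \<sigma>: "\<bar>\<sigma>\<bar> = 1"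
        and le: "\<forall>b\<in>B. x b \<le> \<delta>" "\<forall>i. y i \<le> \<delta>"
        and attained: "(\<exists>b\<in>B. x b = \<delta>) \<or> (\<exists>i. y i = \<delta>)" and \<delta>: "0 < \<delta>" "\<delta> \<le> \<gamma> / (2 * L)"
      have B: "finite B" "card B = D" and p: "\<And>b i. 0 \<le> p b i"
        and row: "\<And>b. b \<in> B \<Longrightarrow> (\<Sum>i\<in>UNIV. p b i) = 1 + \<sigma> * x b / 4"
        and col: "\<And>i. (\<Sum>b\<in>B. p b i) = v i - \<sigma> * (\<beta> i * y i)"
        using plan by (auto simp: perturbed_plan_def)
      let ?V = "x ` B \<union> range y"
      have "card ?V \<le> card (x ` B) + card (range y)" by (rule card_Un_le)
      also have "\<dots> \<le> N" unfolding N_def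
        using B card_image_le[of B x] card_image_le[of UNIV y] by auto
      finally obtain s where s: "0 \<le> s" "s + \<delta> / N \<le> \<delta>"
        "\<And>v. v \<in> ?V \<Longrightarrow> v < s \<or> s + \<delta> / N \<le> v"
        using finite_set_has_gap_below[of ?V N \<delta>] B attained \<delta> by (auto simp: image_iff)
      define h where "h = \<delta> / N"
      have h: "0 < h" using \<delta> N by (simp add: h_def)
      define R where "R = {b\<in>B. s + h \<le> x b}"
      define C where "C = {i. s + h \<le> y i}"
      have outside: "x b < s" if "b \<in> B - R" for b using s(3)[of "x b"] that by (auto simp: R_def h_def)
      have outside': "y i < s" if "i \<notin> C" for i using s(3)[of "y i"] that by (auto simp: C_def h_def)
      have R: "finite R" "R \<subseteq> B" using B by (auto simp: R_def)
      define T where "T = (\<Sum>b\<in>R. x b / 4) + (\<Sum>i\<in>C. \<beta> i * y i)"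
      have pos: "h \<le> x b" if "b \<in> R" for b using that s by (auto simp: R_def)
      have pos': "h \<le> y i" if "i \<in> C" for i using that s by (auto simp: C_def)
      have term1: "\<kappa> * h \<le> x b / 4" if "b \<in> R" for b
        using mult_mono[of \<kappa> "1/4" h "x b"] pos[OF that] \<kappa> h by auto
      have term2: "\<kappa> * h \<le> \<beta> i * y i" if "i \<in> C" for i
        using mult_mono[of \<kappa> "\<beta> i" h "y i"] pos'[OF that] \<kappa> h \<beta>[of i] by auto
      have \<kappa>h: "0 < \<kappa> * h" using \<kappa> h by simp
      have T1: "0 \<le> (\<Sum>b\<in>R. x b / 4)" "0 \<le> (\<Sum>i\<in>C. \<beta> i * y i)"
        using term1 term2 \<kappa>h by (auto intro!: sum_nonneg simp: less_imp_le order_trans) (smt (verit))+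
      have T_low: "\<kappa> * h \<le> T"
        using attained
      proof
        assume "\<exists>b\<in>B. x b = \<delta>"
        then obtain b where b: "b \<in> R" using s by (auto simp: R_def h_def)
        have "x b / 4 \<le> (\<Sum>b\<in>R. x b / 4)"
          by (rule member_le_sum) (use b R pos h in \<open>auto intro: order_trans less_imp_le\<close>)
        then show ?thesis using term1[OF b] T1 by (simp add: T_def)
      next
        assume "\<exists>i. y i = \<delta>"
        then obtain i where i: "i \<in> C" using s by (auto simp: C_def h_def)
        have "\<beta> i * y i \<le> (\<Sum>i\<in>C. \<beta> i * y i)"
          by (rule member_le_sum) (use i term2 \<kappa>h in \<open>auto intro: order_trans less_imp_le\<close>)
        then show ?thesis using term2[OF i] T1 by (simp add: T_def)
      qed
      have "(\<Sum>b\<in>R. x b / 4) \<le> (\<Sum>b\<in>R. \<delta> / 4)"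
        by (intro sum_mono) (use le R in auto)
      also have "\<dots> \<le> D / 4 * \<delta>"
        using card_mono[OF B(1) R(2)] B \<delta> by simp
      finally have U1: "(\<Sum>b\<in>R. x b / 4) \<le> D / 4 * \<delta>" .
      have "(\<Sum>i\<in>C. \<beta> i * y i) \<le> (\<Sum>i\<in>C. \<beta> i * \<delta>)"
        by (intro sum_mono mult_left_mono) (use le \<beta> in \<open>auto intro: less_imp_le\<close>)
      also have "\<dots> \<le> (\<Sum>i\<in>UNIV. \<beta> i * \<delta>)"
        by (intro sum_mono2) (use \<beta> \<delta> in \<open>auto intro: less_imp_le\<close>)
      finally have "T \<le> D / 4 * \<delta> + sum \<beta> UNIV * \<delta>"
        using U1 unfolding T_def sum_distrib_right by linarith
      also have "\<dots> \<le> L * \<delta>" using \<delta> by (simp add: L_def algebra_simps)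
      also have "\<dots> \<le> \<gamma> / 2" using \<delta> L by (simp add: field_simps)
      finally have T_up: "T \<le> \<gamma> / 2" .

      define g where "g = real (card R) - sum v C"
      have "g \<in> G" unfolding G_def g_def using card_mono[OF B(1) R(2)] B by force
      then have "g = 0 \<or> \<gamma> \<le> \<bar>g\<bar>" by (rule \<gamma>)
      moreover have "\<bar>\<sigma> * T\<bar> = T" using \<sigma> T_low \<kappa>h by (simp add: abs_mult)
      ultimately have imbalance: "T \<le> \<bar>g + \<sigma> * T\<bar>" using T_up by linarith

      \<comment> \<open>The mass that crosses the cut, in either direction.\<close>
      define m1 where "m1 = (\<Sum>b\<in>R. \<Sum>i\<in>-C. p b i)"
      define m2 where "m2 = (\<Sum>b\<in>B-R. \<Sum>i\<in>C. p b i)"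
      have m: "0 \<le> m1" "0 \<le> m2" using p by (auto simp: m1_def m2_def intro!: sum_nonneg)
      have UNIV_split: "(\<Sum>i\<in>UNIV. q i) = (\<Sum>i\<in>C. q i) + (\<Sum>i\<in>-C. q i)" for q :: "'i \<Rightarrow> real"
        using sum.union_disjoint[of C "-C" q] by simp
      have B_split: "(\<Sum>b\<in>B. q b) = (\<Sum>b\<in>R. q b) + (\<Sum>b\<in>B-R. q b)" for q :: "'b \<Rightarrow> real"
        using sum.subset_diff[OF R(2) B(1), of q] by simp
      have "(\<Sum>b\<in>R. \<Sum>i\<in>UNIV. p b i) - (\<Sum>i\<in>C. \<Sum>b\<in>B. p b i) = m1 - m2"
        unfolding UNIV_split B_split sum.distrib m1_def m2_def
        using sum.swap[of p C R] sum.swap[of p C "B - R"] by simp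
      moreover have "(\<Sum>b\<in>R. \<Sum>i\<in>UNIV. p b i) = card R + \<sigma> * (\<Sum>b\<in>R. x b / 4)"
        using R row by (simp add: sum.distrib sum_distrib_left subset_iff)
      moreover have "(\<Sum>i\<in>C. \<Sum>b\<in>B. p b i) = sum v C - \<sigma> * (\<Sum>i\<in>C. \<beta> i * y i)"
        by (simp add: col sum_subtractf sum_distrib_left)
      ultimately have "g + \<sigma> * T = m1 - m2" by (simp add: g_def T_def algebra_simps)
      with imbalance m T_low have mass: "\<kappa> * h \<le> m1 + m2" by linarith

      let ?q = "\<lambda>b i. p b i * (x b - y i)\<^sup>2"
      have "(m1 + m2) * h\<^sup>2 = (\<Sum>b\<in>R. \<Sum>i\<in>-C. p b i * h\<^sup>2) + (\<Sum>b\<in>B-R. \<Sum>i\<in>C. p b i * h\<^sup>2)"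
        by (simp add: m1_def m2_def distrib_right sum_distrib_right)
      also have "\<dots> \<le> (\<Sum>b\<in>R. \<Sum>i\<in>-C. ?q b i) + (\<Sum>b\<in>B-R. \<Sum>i\<in>C. ?q b i)"
      proof (intro add_mono sum_mono mult_left_mono p)
        fix b i assume "b \<in> R" "i \<in> - C"
        then have "h \<le> x b - y i" using outside'[of i] by (auto simp: R_def)
        then show "h\<^sup>2 \<le> (x b - y i)\<^sup>2" using h by (intro power_mono) auto
      next
        fix b i assume "b \<in> B - R" "i \<in> C"
        then have "h \<le> y i - x b" using outside[of b] by (auto simp: C_def)
        then have "h\<^sup>2 \<le> (y i - x b)\<^sup>2" using h by (intro power_mono) auto
        then show "h\<^sup>2 \<le> (x b - y i)\<^sup>2" by (simp add: power2_commute)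
      qed
      also have "\<dots> \<le> (\<Sum>b\<in>B. \<Sum>i\<in>UNIV. ?q b i)"
        unfolding UNIV_split B_split sum.distrib using p
        by (auto intro!: sum_nonneg add_nonneg_nonneg simp: add_increasing add_increasing2)
      finally have "(m1 + m2) * h\<^sup>2 \<le> (\<Sum>b\<in>B. \<Sum>i\<in>UNIV. ?q b i)" .
      moreover have "\<kappa> * h * h\<^sup>2 \<le> (m1 + m2) * h\<^sup>2" using mass by (intro mult_right_mono) auto
      moreover have "\<kappa> * h * h\<^sup>2 = \<kappa> / N ^ 3 * \<delta> ^ 3"
        by (simp add: h_def power2_eq_square power3_eq_cube)
      ultimately show "\<kappa> / N ^ 3 * \<delta> ^ 3 \<le> (\<Sum>b\<in>B. \<Sum>i\<in>UNIV. ?q b i)" by linarith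
    qed
  qed
qed

lemma perturbed_plan_cost:
  fixes v \<beta> :: "'i::finite \<Rightarrow> real" and D :: nat
  assumes \<beta>: "\<And>i. 0 < \<beta> i"
  shows "\<exists>\<epsilon>>0. \<exists>c>0. \<forall>(B :: 'b set) p x y \<delta>.
       perturbed_plan D v \<beta> 1 B p x y \<longrightarrow> (\<forall>b\<in>B. \<bar>x b\<bar> \<le> \<delta>) \<longrightarrow> (\<forall>i. \<bar>y i\<bar> \<le> \<delta>) \<longrightarrow>
       ((\<exists>b\<in>B. \<bar>x b\<bar> = \<delta>) \<or> (\<exists>i. \<bar>y i\<bar> = \<delta>)) \<longrightarrow> 0 < \<delta> \<longrightarrow> \<delta> \<le> \<epsilon> \<longrightarrow>
       c * \<delta> ^ 3 \<le> (\<Sum>b\<in>B. \<Sum>i\<in>UNIV. p b i * (x b - y i)\<^sup>2)"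
proof -
  obtain \<epsilon> c where \<epsilon>: "0 < \<epsilon>" and c: "0 < c" and one_sided:
    "\<And>(B :: 'b set) p x y \<sigma> \<delta>. \<lbrakk>perturbed_plan D v \<beta> \<sigma> B p x y; \<bar>\<sigma>\<bar> = 1;
       \<forall>b\<in>B. x b \<le> \<delta>; \<forall>i. y i \<le> \<delta>; (\<exists>b\<in>B. x b = \<delta>) \<or> (\<exists>i. y i = \<delta>); 0 < \<delta>; \<delta> \<le> \<epsilon>\<rbrakk>
     \<Longrightarrow> c * \<delta> ^ 3 \<le> (\<Sum>b\<in>B. \<Sum>i\<in>UNIV. p b i * (x b - y i)\<^sup>2)"
    using perturbed_plan_cost_one_sided[where 'b = 'b, of \<beta> D v, OF \<beta>] by blast
  show ?thesis
  proof (rule exI[of _ \<epsilon>], intro conjI \<epsilon>, rule exI[of _ c], intro conjI c allI impI)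
    fix B :: "'b set" and p :: "'b \<Rightarrow> 'i \<Rightarrow> real" and x y \<delta>
    assume plan: "perturbed_plan D v \<beta> 1 B p x y"
      and le: "\<forall>b\<in>B. \<bar>x b\<bar> \<le> \<delta>" "\<forall>i. \<bar>y i\<bar> \<le> \<delta>"
      and attained: "(\<exists>b\<in>B. \<bar>x b\<bar> = \<delta>) \<or> (\<exists>i. \<bar>y i\<bar> = \<delta>)"
      and \<delta>: "0 < \<delta>" "\<delta> \<le> \<epsilon>"
    consider "(\<exists>b\<in>B. x b = \<delta>) \<or> (\<exists>i. y i = \<delta>)" | "(\<exists>b\<in>B. - x b = \<delta>) \<or> (\<exists>i. - y i = \<delta>)"
      using attained by (auto simp: abs_if split: if_splits)
    then show "c * \<delta> ^ 3 \<le> (\<Sum>b\<in>B. \<Sum>i\<in>UNIV. p b i * (x b - y i)\<^sup>2)"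
    proof cases
      case 1
      show ?thesis
        by (rule one_sided[of 1]) (use 1 plan le \<delta> in \<open>auto simp: abs_le_iff\<close>)
    next
      case 2
      have "perturbed_plan D v \<beta> (-1) B p (\<lambda>b. - x b) (\<lambda>i. - y i)"
        using plan by (simp add: perturbed_plan_def)
      then have "c * \<delta> ^ 3 \<le> (\<Sum>b\<in>B. \<Sum>i\<in>UNIV. p b i * (- x b - - y i)\<^sup>2)"
        by (rule one_sided) (use 2 le \<delta> in \<open>auto simp: abs_le_iff\<close>)
      then show ?thesis by (simp add: power2_commute)
    qed
  qed
qed

section \<open>Eigenbases of self-adjoint operators\<close>

text \<open>
If the defect \<open>w = f u - \<mu> u\<close> were not zero, moving from \<open>u\<close> a little in the direction \<open>w\<close>, which is
orthogonal to \<open>u\<close>, would increase the form to first order at only second-order cost in length.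
\<close>

lemma selfadjoint_quadratic_form_maximizer_is_eigenvector:
  fixes f :: "'a::euclidean_space \<Rightarrow> 'a"
  assumes f: "linear f" and sym: "\<And>x y. f x \<bullet> y = x \<bullet> f y"
    and S: "subspace S" "\<And>x. x \<in> S \<Longrightarrow> f x \<in> S"
    and u: "u \<in> S" "norm u = 1"
    and max: "\<And>x. x \<in> S \<Longrightarrow> norm x = 1 \<Longrightarrow> x \<bullet> f x \<le> u \<bullet> f u"
  shows "f u = (u \<bullet> f u) *\<^sub>R u"
proof -
  define \<mu> where "\<mu> = u \<bullet> f u"
  define w where "w = f u - \<mu> *\<^sub>R u"
  have wS: "w \<in> S" using S u by (simp add: w_def subspace_diff subspace_scale)
  have uu: "u \<bullet> u = 1" using u by (simp add: norm_eq_1)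
  have uw: "u \<bullet> w = 0" by (simp add: w_def inner_diff_right uu \<mu>_def)
  have fuw: "f u \<bullet> w = w \<bullet> w" by (simp add: w_def inner_diff_left inner_diff_right uu algebra_simps)
     (simp add: \<mu>_def inner_commute)
  have bound: "x \<bullet> f x \<le> \<mu> * (x \<bullet> x)" if "x \<in> S" for x
  proof (cases "x = 0")
    case True then show ?thesis by simp
  next
    case False
    have "(x /\<^sub>R norm x) \<bullet> f (x /\<^sub>R norm x) \<le> \<mu>"
      unfolding \<mu>_def by (rule max) (use that S False in \<open>auto simp: subspace_scale\<close>)
    then show ?thesis using False
      by (simp add: linear_scale[OF f] field_simps power2_norm_eq_inner[symmetric] power2_eq_square)
  qed
  \<comment> \<open>The step length \<open>t\<close> is chosen so that the second-order terms, bounded by \<open>t\<^sup>2 K\<close>, are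
    only half as large as the first-order gain \<open>2 t |w|\<^sup>2\<close>.\<close>
  define K where "K = \<bar>w \<bullet> f w\<bar> + \<bar>\<mu>\<bar> * (w \<bullet> w) + 1"
  have K: "0 < K" by (simp add: K_def add_nonneg_pos)
  define t where "t = (w \<bullet> w) / K"
  have "(u + t *\<^sub>R w) \<bullet> f (u + t *\<^sub>R w) \<le> \<mu> * ((u + t *\<^sub>R w) \<bullet> (u + t *\<^sub>R w))"
    by (rule bound) (use S u wS in \<open>auto simp: subspace_add subspace_scale\<close>)
  moreover have "u \<bullet> f w = w \<bullet> w" using fuw sym[of u w] by simp
  moreover have "w \<bullet> f u = w \<bullet> w" using fuw by (simp add: inner_commute)
  ultimately have "2 * t * (w \<bullet> w) + t\<^sup>2 * (w \<bullet> f w) \<le> \<mu> * (t\<^sup>2 * (w \<bullet> w))"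
    using uu uw by (simp add: linear_add[OF f] linear_scale[OF f] inner_add_left inner_add_right
        inner_commute[of w u] \<mu>_def[symmetric] power2_eq_square algebra_simps)
  then have "2 * t * (w \<bullet> w) \<le> t\<^sup>2 * (\<mu> * (w \<bullet> w) - w \<bullet> f w)" by (simp add: algebra_simps)
  also have "\<dots> \<le> t\<^sup>2 * K"
  proof (rule mult_left_mono)
    have "\<mu> * (w \<bullet> w) \<le> \<bar>\<mu>\<bar> * (w \<bullet> w)" by (intro mult_right_mono) auto
    then show "\<mu> * (w \<bullet> w) - w \<bullet> f w \<le> K" by (simp add: K_def)
  qed simp
  also have "\<dots> = t * (w \<bullet> w)" using K by (simp add: t_def power2_eq_square)
  finally have "t * (w \<bullet> w) \<le> 0" by simp
  then have "w = 0" using K by (simp add: t_def divide_le_0_iff mult_le_0_iff)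
     (metis inner_ge_zero inner_eq_zero_iff order_antisym)
  then show ?thesis by (simp add: w_def \<mu>_def)
qed

text \<open>
The spectral theorem, by splitting off a maximizer of the quadratic form on the unit sphere: its orthogonal
complement in \<open>S\<close> is again invariant.
\<close>

lemma selfadjoint_eigenbasis_of_invariant_subspace:
  fixes f :: "'a::euclidean_space \<Rightarrow> 'a"
  assumes f: "linear f" and sym: "\<And>x y. f x \<bullet> y = x \<bullet> f y"
  shows "subspace S \<Longrightarrow> (\<And>x. x \<in> S \<Longrightarrow> f x \<in> S) \<Longrightarrow>
    \<exists>B. B \<subseteq> S \<and> pairwise orthogonal B \<and> (\<forall>b\<in>B. norm b = 1 \<and> f b = (b \<bullet> f b) *\<^sub>R b) \<and> span B = S"
proof (induction "dim S" arbitrary: S rule: less_induct)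
  case less
  show ?case
  proof (cases "S = {0}")
    case True
    then show ?thesis by (intro exI[of _ "{}"]) auto
  next
    case False
    have S: "subspace S" and inv: "\<And>x. x \<in> S \<Longrightarrow> f x \<in> S" using less.prems by auto
    obtain z where z: "z \<in> S" "z \<noteq> 0" using False S subspace_0 by blast
    let ?K = "sphere 0 1 \<inter> S"
    have "z /\<^sub>R norm z \<in> ?K" using z S by (auto simp: subspace_scale)
    moreover have "compact ?K" by (intro compact_Int_closed closed_subspace S) auto
    moreover have "continuous_on ?K (\<lambda>x. x \<bullet> f x)"
      by (intro continuous_intros linear_continuous_on_compose[OF _ f])
    ultimately obtain u where u: "u \<in> ?K" and max: "\<And>x. x \<in> ?K \<Longrightarrow> x \<bullet> f x \<le> u \<bullet> f u"
      using continuous_attains_sup[of ?K "\<lambda>x. x \<bullet> f x"] by blast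
    have uS: "u \<in> S" "norm u = 1" using u by auto
    have eig: "f u = (u \<bullet> f u) *\<^sub>R u"
      by (rule selfadjoint_quadratic_form_maximizer_is_eigenvector[OF f sym S inv uS]) (use max in auto)
    have uu: "u \<bullet> u = 1" using uS by (simp add: norm_eq_1)
    define T where "T = S \<inter> {x. u \<bullet> x = 0}"
    have T: "subspace T" unfolding T_def by (intro subspace_inter S subspace_hyperplane)
    have "u \<notin> T" using uu by (simp add: T_def)
    then have "T \<subset> S" using uS(1) unfolding T_def by blast
    then have "dim T < dim S"
      using T S by (metis dim_subset dim_eq_span order_le_less psubsetE span_eq_iff)
    moreover have "f x \<in> T" if "x \<in> T" for x
    proof -
      have "u \<bullet> f x = f u \<bullet> x" using sym by simp
      also have "\<dots> = (u \<bullet> f u) * (u \<bullet> x)" by (metis eig inner_scaleR_left)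
      finally show ?thesis using that inv by (simp add: T_def)
    qed
    ultimately obtain B where B: "B \<subseteq> T" "pairwise orthogonal B"
      "\<forall>b\<in>B. norm b = 1 \<and> f b = (b \<bullet> f b) *\<^sub>R b" "span B = T"
      using less.hyps[OF _ T] by blast
    have "span (insert u B) = S"
    proof
      show "span (insert u B) \<subseteq> S"
        using uS B by (intro span_minimal S) (auto simp: T_def)
      show "S \<subseteq> span (insert u B)"
      proof
        fix x assume x: "x \<in> S"
        have "x - (u \<bullet> x) *\<^sub>R u \<in> T"
          using x uS S uu by (simp add: T_def subspace_diff subspace_scale inner_diff_right)
        then show "x \<in> span (insert u B)" using B by (auto simp: span_insert)
      qed
    qed
    moreover have "pairwise orthogonal (insert u B)"
      using B by (auto simp: pairwise_insert orthogonal_def T_def inner_commute)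
    ultimately show ?thesis
      using uS eig B by (intro exI[of _ "insert u B"]) (auto simp: T_def)
  qed
qed

lemma selfadjoint_orthonormal_eigenbasis:
  fixes f :: "'a::euclidean_space \<Rightarrow> 'a"
  assumes f: "linear f" and sym: "\<And>x y. f x \<bullet> y = x \<bullet> f y"
  obtains B where "finite B" "card B = DIM('a)" "\<And>b. b \<in> B \<Longrightarrow> norm b = 1"
    "\<And>b. b \<in> B \<Longrightarrow> f b = (b \<bullet> f b) *\<^sub>R b" "\<And>w. (\<Sum>b\<in>B. (b \<bullet> w)\<^sup>2) = (norm w)\<^sup>2"
proof -
  obtain B where B: "pairwise orthogonal B" "\<forall>b\<in>B. norm b = 1 \<and> f b = (b \<bullet> f b) *\<^sub>R b" "span B = UNIV"
    using selfadjoint_eigenbasis_of_invariant_subspace[OF f sym, of UNIV] by auto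
  have indep: "independent B"
    using B by (intro pairwise_orthogonal_independent) auto
  have fin: "finite B" using indep independent_imp_finite by blast
  have "card B = DIM('a)"
    using indep B(3) by (metis dim_UNIV dim_span dim_eq_card_independent)
  moreover have "(\<Sum>b\<in>B. (b \<bullet> w)\<^sup>2) = (norm w)\<^sup>2" for w
  proof -
    have w: "w \<in> span B" using B by simp
    have "w \<bullet> w = (\<Sum>b\<in>B. (w \<bullet> b) *\<^sub>R b) \<bullet> w"
      using orthonormal_basis_expand[of B w] B w fin by simp
    also have "\<dots> = (\<Sum>b\<in>B. (b \<bullet> w)\<^sup>2)"
      unfolding inner_sum_left inner_scaleR_left power2_eq_square by (simp add: inner_commute)
    finally show ?thesis by (simp add: power2_norm_eq_inner)
  qed
  ultimately show ?thesis using that[of B] fin B by auto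
qed

section \<open>The gradient of the total frame energy\<close>

definition frame_defect :: "complex^'n^'d \<Rightarrow> complex^'d^'d" where
  "frame_defect F = F ** adjoint_matrix F - mat 1"

definition norm_defect :: "real^'n \<Rightarrow> complex^'n^'d \<Rightarrow> 'n \<Rightarrow> real" where
  "norm_defect r F i = ((norm (column i F))\<^sup>2 / r $ i - 1) / r $ i"

definition energy_gradient :: "real^'n \<Rightarrow> complex^'n^'d \<Rightarrow> complex^'n^'d" where
  "energy_gradient r F =
     (\<chi> a i. 4 * (frame_defect F ** F) $ a $ i + of_real (norm_defect r F i) * F $ a $ i)"

lemma inner_complex_eq: "x \<bullet> y = Re (cnj x * y)" for x y :: complex
  by (simp add: inner_complex_def)

lemma inner_matrix_eq:
  fixes X Y :: "complex^'n^'d"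
  shows "X \<bullet> Y = Re (\<Sum>a\<in>UNIV. \<Sum>i\<in>UNIV. cnj (X $ a $ i) * Y $ a $ i)"
  by (simp add: inner_vec_def inner_complex_eq)

text \<open>
Right multiplication by \<open>Y\<close> is adjoint to right multiplication by \<open>Y\<^sup>*\<close>.
\<close>

lemma inner_matrix_mult_left:
  fixes X :: "complex^'m^'d" and Y :: "complex^'n^'m" and Z :: "complex^'n^'d"
  shows "(X ** Y) \<bullet> Z = X \<bullet> (Z ** adjoint_matrix Y)"
proof -
  have "(\<Sum>i\<in>UNIV. cnj ((X ** Y) $ a $ i) * Z $ a $ i)
      = (\<Sum>m\<in>UNIV. cnj (X $ a $ m) * (Z ** adjoint_matrix Y) $ a $ m)" for a
  proof -
    have "(\<Sum>i\<in>UNIV. cnj ((X ** Y) $ a $ i) * Z $ a $ i)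
        = (\<Sum>i\<in>UNIV. \<Sum>m\<in>UNIV. cnj (X $ a $ m) * (Z $ a $ i * cnj (Y $ m $ i)))"
      by (simp add: matrix_matrix_mult_def sum_distrib_right sum_distrib_left mult_ac)
    also have "\<dots> = (\<Sum>m\<in>UNIV. \<Sum>i\<in>UNIV. cnj (X $ a $ m) * (Z $ a $ i * cnj (Y $ m $ i)))"
      by (rule sum.swap)
    also have "\<dots> = (\<Sum>m\<in>UNIV. cnj (X $ a $ m) * (Z ** adjoint_matrix Y) $ a $ m)"
      by (simp add: matrix_matrix_mult_def adjoint_matrix_def sum_distrib_left)
    finally show ?thesis .
  qed
  then show ?thesis by (simp add: inner_matrix_eq)
qed

lemma inner_adjoint_matrix:
  fixes X Y :: "complex^'n^'d"
  shows "adjoint_matrix X \<bullet> adjoint_matrix Y = X \<bullet> Y"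
proof -
  have "adjoint_matrix X \<bullet> adjoint_matrix Y = (\<Sum>i\<in>UNIV. \<Sum>a\<in>UNIV. X $ a $ i \<bullet> Y $ a $ i)"
    by (simp add: inner_vec_def adjoint_matrix_def inner_complex_def)
  also have "\<dots> = (\<Sum>a\<in>UNIV. \<Sum>i\<in>UNIV. X $ a $ i \<bullet> Y $ a $ i)" by (rule sum.swap)
  finally show ?thesis by (simp add: inner_vec_def)
qed

lemma adjoint_matrix_mult:
  fixes X :: "complex^'m^'d" and Y :: "complex^'n^'m"
  shows "adjoint_matrix (X ** Y) = adjoint_matrix Y ** adjoint_matrix X"
  by (simp add: adjoint_matrix_def matrix_matrix_mult_def vec_eq_iff mult.commute)

lemma adjoint_adjoint_matrix [simp]: "adjoint_matrix (adjoint_matrix X) = X"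
  by (simp add: adjoint_matrix_def vec_eq_iff)

lemma adjoint_frame_defect:
  fixes F :: "complex^'n^'d"
  shows "adjoint_matrix (frame_defect F) = frame_defect F"
proof -
  have "adjoint_matrix (X - Y) = adjoint_matrix X - adjoint_matrix Y" for X Y :: "complex^'d^'d"
    by (simp add: adjoint_matrix_def vec_eq_iff)
  moreover have "adjoint_matrix (mat 1 :: complex^'d^'d) = mat 1"
    by (simp add: adjoint_matrix_def vec_eq_iff mat_def)
  ultimately show ?thesis by (simp add: frame_defect_def adjoint_matrix_mult)
qed

lemma total_frame_energy_eq:
  assumes "\<And>i. r $ i \<noteq> 0"
  shows "total_frame_energy r F =
    (norm (frame_defect F))\<^sup>2 + 1 / 4 * (\<Sum>i\<in>UNIV. (r $ i * norm_defect r F i)\<^sup>2)"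
  using assms by (simp add: total_frame_energy_def frame_defect_def norm_defect_def)

lemma inner_eq_sum_columns:
  fixes X Y :: "complex^'n^'d"
  shows "X \<bullet> Y = (\<Sum>i\<in>UNIV. column i X \<bullet> column i Y)"
  unfolding inner_vec_def column_def by (simp add: inner_vec_def) (rule sum.swap)

lemma column_energy_gradient:
  "column i (energy_gradient r F) =
     4 *\<^sub>R (frame_defect F *v column i F) + norm_defect r F i *\<^sub>R column i F"
  by (simp add: vec_eq_iff column_def energy_gradient_def matrix_matrix_mult_def
      matrix_vector_mult_def scaleR_conv_of_real[where 'a = complex])

lemma inner_energy_gradient:
  "X \<bullet> energy_gradient r F =
     4 * (X \<bullet> (frame_defect F ** F)) + (\<Sum>i\<in>UNIV. norm_defect r F i * (column i X \<bullet> column i F))"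
proof -
  have "column i (frame_defect F ** F) = frame_defect F *v column i F" for i
    by (simp add: vec_eq_iff column_def matrix_matrix_mult_def matrix_vector_mult_def)
  then show ?thesis
    unfolding inner_eq_sum_columns column_energy_gradient inner_add_right sum.distrib
    by (simp add: sum_distrib_left)
qed

lemma bounded_linear_adjoint_matrix: "bounded_linear (adjoint_matrix :: complex^'n^'d \<Rightarrow> _)"
  by (intro linear_conv_bounded_linear[THEN iffD1] linearI)
     (simp_all add: adjoint_matrix_def vec_eq_iff)

lemma bounded_linear_column: "bounded_linear (column i :: complex^'n^'d \<Rightarrow> _)"
  by (intro linear_conv_bounded_linear[THEN iffD1] linearI)
     (simp_all add: column_def vec_eq_iff)

lemma bounded_bilinear_matrix_mult:
  "bounded_bilinear ((**) :: complex^'m^'d \<Rightarrow> complex^'n^'m \<Rightarrow> complex^'n^'d)"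
  unfolding bilinear_conv_bounded_bilinear[symmetric] bilinear_def
  by (auto simp: vec_eq_iff matrix_matrix_mult_def sum.distrib algebra_simps scaleR_sum_right
      intro!: linearI)

text \<open>
For a Hermitian \<open>M\<close> the two halves \<open>h F\<^sup>*\<close> and \<open>F h\<^sup>*\<close> of the variation of \<open>F F\<^sup>*\<close> have the same inner
product with \<open>M\<close>; hence the factor \<open>4\<close>.
\<close>

lemma GDERIV_total_frame_energy:
  fixes F :: "complex^'n^'d"
  assumes "\<And>i. r $ i \<noteq> 0"
  shows "GDERIV (total_frame_energy r) F :> energy_gradient r F"
proof -
  note adj = bounded_linear.has_derivative[OF bounded_linear_adjoint_matrix]
    and col = bounded_linear.has_derivative[OF bounded_linear_column]
    and mult = bounded_bilinear.FDERIV[OF bounded_bilinear_matrix_mult]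
  have M: "(frame_defect has_derivative (\<lambda>h. F ** adjoint_matrix h + h ** adjoint_matrix F)) (at F)"
    unfolding frame_defect_def by (rule derivative_eq_intros mult adj refl)+ simp
  have "((\<lambda>F. frame_defect F \<bullet> frame_defect F) has_derivative
      (\<lambda>h. 4 * (h \<bullet> (frame_defect F ** F)))) (at F)"
  proof (rule has_derivative_eq_rhs[OF has_derivative_inner[OF M M]], rule ext)
    fix h :: "complex^'n^'d"
    let ?M = "frame_defect F"
    have "?M \<bullet> (h ** adjoint_matrix F) = h \<bullet> (?M ** F)"
      using inner_matrix_mult_left[of ?M F h] by (simp add: inner_commute)
    moreover have "?M \<bullet> (F ** adjoint_matrix h) = ?M \<bullet> (h ** adjoint_matrix F)"
      using inner_adjoint_matrix[of ?M "F ** adjoint_matrix h"]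
      by (simp add: adjoint_frame_defect adjoint_matrix_mult)
    ultimately show "?M \<bullet> (F ** adjoint_matrix h + h ** adjoint_matrix F)
        + (F ** adjoint_matrix h + h ** adjoint_matrix F) \<bullet> ?M = 4 * (h \<bullet> (?M ** F))"
      by (simp add: inner_add_right inner_add_left inner_commute)
  qed
  moreover have "((\<lambda>F. ((norm (column i F))\<^sup>2 / r $ i - 1)\<^sup>2) has_derivative
      (\<lambda>h. 4 * (norm_defect r F i * (column i h \<bullet> column i F)))) (at F)" for i
    unfolding power2_norm_eq_inner
    by (rule derivative_eq_intros col refl assms)+
       (use assms[of i] in \<open>auto simp: fun_eq_iff norm_defect_def power2_norm_eq_inner inner_commute field_simps\<close>)
  ultimately have "((\<lambda>F. frame_defect F \<bullet> frame_defect F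
        + 1 / 4 * (\<Sum>i\<in>UNIV. ((norm (column i F))\<^sup>2 / r $ i - 1)\<^sup>2)) has_derivative
      (\<lambda>h. 4 * (h \<bullet> (frame_defect F ** F))
        + 1 / 4 * (\<Sum>i\<in>UNIV. 4 * (norm_defect r F i * (column i h \<bullet> column i F))))) (at F)"
    by (intro has_derivative_add has_derivative_mult_right has_derivative_sum) auto
  then show ?thesis
    unfolding gderiv_def inner_energy_gradient total_frame_energy_def [abs_def]
      frame_defect_def[symmetric] power2_norm_eq_inner[of "frame_defect _"]
    by (simp add: sum_distrib_left)
qed

section \<open>A Lojasiewicz inequality at the Parseval frames\<close>

lemma inner_matrix_vector_mult:
  fixes X :: "complex^'n^'d"
  shows "(X *v u) \<bullet> w = u \<bullet> (adjoint_matrix X *v w)"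
proof -
  have "(\<Sum>a\<in>UNIV. cnj ((X *v u) $ a) * w $ a)
      = (\<Sum>a\<in>UNIV. \<Sum>i\<in>UNIV. cnj (u $ i) * (cnj (X $ a $ i) * w $ a))"
    by (simp add: matrix_vector_mult_def sum_distrib_right sum_distrib_left mult_ac)
  also have "\<dots> = (\<Sum>i\<in>UNIV. \<Sum>a\<in>UNIV. cnj (u $ i) * (cnj (X $ a $ i) * w $ a))"
    by (rule sum.swap)
  also have "\<dots> = (\<Sum>i\<in>UNIV. cnj (u $ i) * (adjoint_matrix X *v w) $ i)"
    by (simp add: matrix_vector_mult_def adjoint_matrix_def sum_distrib_left)
  finally show ?thesis
    unfolding inner_vec_def inner_complex_eq Re_sum[symmetric] by simp
qed

text \<open>
The eigenbasis used below is one of \<open>complex^'d\<close> as a \<^emph>\<open>real\<close> space, so it has \<open>2 d\<close> members. The squared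
modulus of a Hermitian product is then the sum of the squared real inner products with a vector and
with its multiple by \<open>\<i>\<close>, which is what \<open>spectral_weight\<close> records.
\<close>

definition imaginary_multiple :: "complex^'d \<Rightarrow> complex^'d" where
  "imaginary_multiple w = \<i> *s w"

lemma norm_imaginary_multiple: "norm (imaginary_multiple w) = norm w"
  by (simp add: imaginary_multiple_def norm_vec_def norm_mult)

lemma sum_norm_column_sq:
  fixes X :: "complex^'n^'d"
  shows "(\<Sum>i\<in>UNIV. (norm (column i X))\<^sup>2) = (norm X)\<^sup>2"
  unfolding power2_norm_eq_inner by (simp add: inner_eq_sum_columns)

text \<open>
A crude constant suffices: it only enters the radius \<open>\<epsilon>\<close> of the Lojasiewicz inequality.
\<close>

lemma norm_matrix_vector_mult_le:
  fixes X :: "complex^'n^'d"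
  shows "norm (X *v u) \<le> real CARD('d) * real CARD('n) * norm X * norm u"
proof -
  have "norm (X *v u) \<le> (\<Sum>a\<in>UNIV. norm ((X *v u) $ a))"
    unfolding norm_vec_def by (rule L2_set_le_sum) simp
  also have "\<dots> \<le> (\<Sum>a\<in>(UNIV::'d set). \<Sum>i\<in>(UNIV::'n set). norm X * norm u)"
  proof (rule sum_mono)
    fix a :: 'd
    have "norm ((X *v u) $ a) \<le> (\<Sum>i\<in>UNIV. norm (X $ a $ i * u $ i))"
      unfolding matrix_vector_mult_def by (simp add: norm_sum)
    also have "\<dots> \<le> (\<Sum>i\<in>(UNIV::'n set). norm X * norm u)"
      unfolding norm_mult
      by (intro sum_mono mult_mono Finite_Cartesian_Product.norm_nth_le)
         (auto intro: order_trans[OF Finite_Cartesian_Product.norm_nth_le])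
    finally show "norm ((X *v u) $ a) \<le> (\<Sum>i\<in>(UNIV::'n set). norm X * norm u)" .
  qed
  finally show ?thesis by (simp add: mult_ac)
qed

lemma norm_squared_le_of_operator_bound:
  fixes X :: "complex^'n^'d"
  assumes "\<And>u. norm (X *v u) \<le> k * norm u"
  shows "(norm X)\<^sup>2 \<le> real CARD('n) * k\<^sup>2"
proof -
  have "(norm X)\<^sup>2 = (\<Sum>i\<in>UNIV. (norm (X *v axis i 1))\<^sup>2)"
  proof -
    have "X *v axis i 1 = column i X" for i
      by (simp add: vec_eq_iff matrix_vector_mult_def axis_def column_def if_distrib cong: if_cong)
    then show ?thesis by (simp add: sum_norm_column_sq)
  qed
  also have "\<dots> \<le> (\<Sum>i\<in>(UNIV::'n set). k\<^sup>2)"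
  proof (intro sum_mono power_mono)
    fix i :: 'n
    have "norm (axis i 1 :: complex^'n) = 1"
      by (simp add: norm_eq_1 inner_axis_axis inner_complex_def)
    then show "norm (X *v axis i 1) \<le> k" using assms[of "axis i 1"] by simp
  qed simp
  finally show ?thesis by simp
qed

definition spectral_weight :: "complex^'n^'d \<Rightarrow> complex^'d \<Rightarrow> 'n \<Rightarrow> real" where
  "spectral_weight F b i =
     (b \<bullet> column i F)\<^sup>2 + (b \<bullet> imaginary_multiple (column i F))\<^sup>2"

text \<open>
The weight is \<open>|(F\<^sup>* b)\<^sub>i|\<^sup>2\<close>, so the sum is \<open>|F\<^sup>* b|\<^sup>2 = b \<bullet> F F\<^sup>* b\<close>. For a unit eigenvector of the
frame defect with eigenvalue \<open>\<mu>\<close> this gives the row sum \<open>1 + \<mu>\<close> of a perturbed plan.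
\<close>

lemma sum_spectral_weight_columns:
  fixes F :: "complex^'n^'d"
  shows "(\<Sum>i\<in>UNIV. spectral_weight F b i) = (norm b)\<^sup>2 + b \<bullet> (frame_defect F *v b)"
proof -
  have "spectral_weight F b i = (norm ((adjoint_matrix F *v b) $ i))\<^sup>2" for i
  proof -
    have "b \<bullet> column i F = Re ((adjoint_matrix F *v b) $ i)"
      by (simp add: inner_vec_def matrix_vector_mult_def adjoint_matrix_def column_def
          inner_complex_def algebra_simps)
    moreover have "b \<bullet> imaginary_multiple (column i F) = Im ((adjoint_matrix F *v b) $ i)"
      by (simp add: inner_vec_def matrix_vector_mult_def adjoint_matrix_def column_def
          inner_complex_def imaginary_multiple_def algebra_simps)
    ultimately show ?thesis by (simp add: spectral_weight_def cmod_power2)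
  qed
  then have "(\<Sum>i\<in>UNIV. spectral_weight F b i) = (adjoint_matrix F *v b) \<bullet> (adjoint_matrix F *v b)"
    by (simp add: inner_vec_def power2_norm_eq_inner)
  also have "\<dots> = b \<bullet> ((F ** adjoint_matrix F) *v b)"
    using inner_matrix_vector_mult[of "adjoint_matrix F" b] by (simp add: matrix_vector_mul_assoc)
  also have "F ** adjoint_matrix F = mat 1 + frame_defect F" by (simp add: frame_defect_def)
  finally show ?thesis
    by (simp add: matrix_vector_mult_add_rdistrib inner_add_right power2_norm_eq_inner)
qed

text \<open>
In the eigenbasis the operator \<open>4 M + \<nu>\<^sub>i\<close> that makes up the \<open>i\<close>-th column of the gradient is diagonal.
The factor \<open>2\<close> appears because a column and its multiple by \<open>\<i>\<close> contribute equally.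
\<close>

lemma sum_spectral_weight_eq_norm_gradient:
  fixes F :: "complex^'n^'d"
  assumes parseval: "\<And>w. (\<Sum>b\<in>B. (b \<bullet> w)\<^sup>2) = (norm w)\<^sup>2"
    and eig: "\<And>b. b \<in> B \<Longrightarrow> frame_defect F *v b = \<mu> b *\<^sub>R b"
  shows "(\<Sum>b\<in>B. \<Sum>i\<in>UNIV. spectral_weight F b i * (4 * \<mu> b + norm_defect r F i)\<^sup>2)
    = 2 * (norm (energy_gradient r F))\<^sup>2"
proof -
  let ?G = "energy_gradient r F"
  have sym: "b \<bullet> (frame_defect F *v w) = (frame_defect F *v b) \<bullet> w" for b w
    by (simp add: inner_matrix_vector_mult adjoint_frame_defect)
  have G: "b \<bullet> column i ?G = (4 * \<mu> b + norm_defect r F i) * (b \<bullet> column i F)" if "b \<in> B" for b i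
    by (simp add: column_energy_gradient inner_add_right sym eig[OF that] algebra_simps)
  have J: "imaginary_multiple (column i ?G) = 4 *\<^sub>R (frame_defect F *v imaginary_multiple (column i F))
      + norm_defect r F i *\<^sub>R imaginary_multiple (column i F)" for i
    by (simp add: column_energy_gradient imaginary_multiple_def vec_eq_iff matrix_vector_mult_def
        sum_distrib_left algebra_simps scaleR_conv_of_real[where 'a = complex])
  have JG: "b \<bullet> imaginary_multiple (column i ?G)
      = (4 * \<mu> b + norm_defect r F i) * (b \<bullet> imaginary_multiple (column i F))" if "b \<in> B" for b i
    by (simp add: J inner_add_right sym eig[OF that] algebra_simps)
  have "(\<Sum>b\<in>B. \<Sum>i\<in>UNIV. spectral_weight F b i * (4 * \<mu> b + norm_defect r F i)\<^sup>2)
      = (\<Sum>b\<in>B. \<Sum>i\<in>UNIV. (b \<bullet> column i ?G)\<^sup>2 + (b \<bullet> imaginary_multiple (column i ?G))\<^sup>2)"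
    by (intro sum.cong refl)
       (simp add: G JG spectral_weight_def power_mult_distrib, simp add: distrib_left distrib_right mult.commute)
  also have "\<dots> = (\<Sum>i\<in>UNIV. \<Sum>b\<in>B. (b \<bullet> column i ?G)\<^sup>2 + (b \<bullet> imaginary_multiple (column i ?G))\<^sup>2)"
    by (rule sum.swap)
  also have "\<dots> = 2 * (\<Sum>i\<in>UNIV. (norm (column i ?G))\<^sup>2)"
    by (simp add: sum.distrib parseval norm_imaginary_multiple sum_distrib_left)
  finally show ?thesis by (simp add: sum_norm_column_sq)
qed

lemma total_frame_energy_nonneg: "0 \<le> total_frame_energy r F"
  by (simp add: total_frame_energy_def sum_nonneg)

text \<open>
With \<open>x = 4 \<mu>\<close> and \<open>y = - \<nu>\<close> the spectral weights form a perturbed plan whose cost is twice the squared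
gradient. If \<open>\<delta>\<close> is the largest modulus of a potential, then \<open>E\<close> is at most of order \<open>\<delta>\<^sup>2\<close>, while the
cost is at least of order \<open>\<delta>\<^sup>3\<close>: the gradient has at least the order of \<open>E powr (3/4)\<close>.
\<close>

lemma total_frame_energy_Lojasiewicz:
  fixes r :: "real^'n"
  assumes r: "\<And>i. 0 < r $ i"
  shows "\<exists>\<epsilon>>0. \<exists>C. \<forall>F :: complex^'n^'d. total_frame_energy r F < \<epsilon> \<longrightarrow>
    total_frame_energy r F ^ 3 \<le> C * norm (energy_gradient r F) ^ 4"
proof -
  \<comment> \<open>Twice the column sums of a complex eigenbasis, as the eigenbasis is one of a real space of dimension \<open>2 d\<close>.\<close>
  let ?v = "\<lambda>i. 2 * r $ i" and ?\<beta> = "\<lambda>i. 2 * (r $ i)\<^sup>2"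
  let ?E = "total_frame_energy r :: complex^'n^'d \<Rightarrow> real"
  have r0: "r $ i \<noteq> 0" for i using r[of i] by simp
  obtain \<epsilon> c where \<epsilon>: "0 < \<epsilon>" and c: "0 < c" and cost:
    "\<And>(B :: (complex^'d) set) p x y \<delta>. \<lbrakk>perturbed_plan DIM(complex^'d) ?v ?\<beta> 1 B p x y;
       \<forall>b\<in>B. \<bar>x b\<bar> \<le> \<delta>; \<forall>i. \<bar>y i\<bar> \<le> \<delta>; (\<exists>b\<in>B. \<bar>x b\<bar> = \<delta>) \<or> (\<exists>i. \<bar>y i\<bar> = \<delta>); 0 < \<delta>; \<delta> \<le> \<epsilon>\<rbrakk>
     \<Longrightarrow> c * \<delta> ^ 3 \<le> (\<Sum>b\<in>B. \<Sum>i\<in>UNIV. p b i * (x b - y i)\<^sup>2)"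
  proof -
    have "0 < ?\<beta> i" for i using r[of i] by simp
    from perturbed_plan_cost[where 'b = "complex^'d", of ?\<beta> "DIM(complex^'d)" ?v, OF this]
    show thesis using that by blast
  qed
  \<comment> \<open>The constants of \<open>E \<le> K \<delta>\<^sup>2\<close> and of \<open>\<delta>\<^sup>2 \<le> H E\<close>.\<close>
  define K where "K = real CARD('d) + (\<Sum>i\<in>UNIV. (r $ i)\<^sup>2)"
  define H where "H = 16 * (real CARD('d) * real CARD('d))\<^sup>2 + (\<Sum>i\<in>UNIV. 4 / (r $ i)\<^sup>2)"
  have K: "0 < K" by (simp add: K_def add_pos_nonneg sum_nonneg)
  have H: "0 < H" by (simp add: H_def add_pos_nonneg sum_nonneg)
  show ?thesis
  proof (rule exI[of _ "\<epsilon>\<^sup>2 / H"], intro conjI, goal_cases)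
    case 1
    show ?case using \<epsilon> H by simp
  next
    case 2
    show ?case
    proof (rule exI[of _ "4 * K ^ 3 / c\<^sup>2"], intro allI impI)
      fix F :: "complex^'n^'d" assume small: "?E F < \<epsilon>\<^sup>2 / H"
      let ?M = "frame_defect F" and ?\<nu> = "norm_defect r F"
      have E: "?E F = (norm ?M)\<^sup>2 + 1 / 4 * (\<Sum>i\<in>UNIV. (r $ i * ?\<nu> i)\<^sup>2)"
        by (rule total_frame_energy_eq) (rule r0)
      have lin: "linear ((*v) ?M)"
        by (rule linearI) (simp_all add: vec_eq_iff matrix_vector_mult_def algebra_simps sum.distrib scaleR_sum_right)
      obtain B where B: "finite B" "card B = DIM(complex^'d)" "\<And>b. b \<in> B \<Longrightarrow> norm b = 1"
        and eig: "\<And>b. b \<in> B \<Longrightarrow> ?M *v b = (b \<bullet> (?M *v b)) *\<^sub>R b"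
        and parseval: "\<And>w. (\<Sum>b\<in>B. (b \<bullet> w)\<^sup>2) = (norm w)\<^sup>2"
        using selfadjoint_orthonormal_eigenbasis[OF lin]
        by (metis inner_matrix_vector_mult adjoint_frame_defect)
      define \<mu> where "\<mu> b = b \<bullet> (?M *v b)" for b
      define x where "x b = 4 * \<mu> b" for b
      define y where "y i = - ?\<nu> i" for i
      define p where "p = spectral_weight F"
      have plan: "perturbed_plan DIM(complex^'d) ?v ?\<beta> 1 B p x y"
        unfolding perturbed_plan_def
      proof (intro conjI allI ballI B)
        show "0 \<le> p b i" for b i by (simp add: p_def spectral_weight_def)
        show "(\<Sum>i\<in>UNIV. p b i) = 1 + 1 * x b / 4" if "b \<in> B" for b
          using B(3)[OF that] by (simp add: p_def sum_spectral_weight_columns x_def \<mu>_def)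
        have "(\<Sum>b\<in>B. p b i) = 2 * (norm (column i F))\<^sup>2" for i
          by (simp add: p_def spectral_weight_def sum.distrib parseval norm_imaginary_multiple)
        then show "(\<Sum>b\<in>B. p b i) = ?v i - 1 * (?\<beta> i * y i)" for i
          using r0[of i] by (simp add: y_def norm_defect_def power2_eq_square field_simps)
      qed
      define \<delta> where "\<delta> = Max ((\<lambda>b. \<bar>x b\<bar>) ` B \<union> range (\<lambda>i. \<bar>y i\<bar>))"
      have fin: "finite ((\<lambda>b. \<bar>x b\<bar>) ` B \<union> range (\<lambda>i. \<bar>y i\<bar>))" using B by simp
      have le: "\<forall>b\<in>B. \<bar>x b\<bar> \<le> \<delta>" "\<forall>i. \<bar>y i\<bar> \<le> \<delta>"
        using fin by (auto simp: \<delta>_def intro!: Max_ge)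
      have attained: "(\<exists>b\<in>B. \<bar>x b\<bar> = \<delta>) \<or> (\<exists>i. \<bar>y i\<bar> = \<delta>)"
        using Max_in[OF fin] unfolding \<delta>_def[symmetric] by auto
      then have \<delta>0: "0 \<le> \<delta>" by auto

      have "(x b)\<^sup>2 \<le> H * ?E F" if "b \<in> B" for b
      proof -
        have "\<bar>\<mu> b\<bar> = norm (?M *v b)" using eig[OF that] B(3)[OF that] unfolding \<mu>_def
          by (metis mult.right_neutral norm_scaleR)
        also have "\<dots> \<le> real CARD('d) * real CARD('d) * norm ?M"
          using norm_matrix_vector_mult_le[of ?M b] B(3)[OF that] by simp
        finally have "\<bar>x b\<bar> \<le> 4 * (real CARD('d) * real CARD('d) * norm ?M)" by (simp add: x_def)
        then have "\<bar>x b\<bar>\<^sup>2 \<le> (4 * (real CARD('d) * real CARD('d) * norm ?M))\<^sup>2"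
          by (rule power_mono) simp
        also have "\<dots> = 16 * (real CARD('d) * real CARD('d))\<^sup>2 * (norm ?M)\<^sup>2"
          by (simp add: power_mult_distrib)
        also have "\<dots> \<le> H * ?E F"
          by (intro mult_mono) (auto simp: H_def E intro!: sum_nonneg add_nonneg_nonneg)
        finally show ?thesis by simp
      qed
      moreover have "(y i)\<^sup>2 \<le> H * ?E F" for i
      proof -
        have "(r $ i * ?\<nu> i)\<^sup>2 \<le> (\<Sum>i\<in>UNIV. (r $ i * ?\<nu> i)\<^sup>2)" by (rule member_le_sum) auto
        then have "(r $ i * ?\<nu> i)\<^sup>2 \<le> 4 * ?E F" by (simp add: E add_increasing)
        then have "(y i)\<^sup>2 \<le> 4 / (r $ i)\<^sup>2 * ?E F"
          using r0[of i] by (simp add: y_def power_mult_distrib field_simps)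
        also have "4 / (r $ i)\<^sup>2 \<le> (\<Sum>i\<in>UNIV. 4 / (r $ i)\<^sup>2)"
          by (rule member_le_sum) auto
        then have "4 / (r $ i)\<^sup>2 * ?E F \<le> H * ?E F"
          by (intro mult_right_mono) (auto simp: H_def total_frame_energy_nonneg intro: add_increasing)
        finally show ?thesis .
      qed
      ultimately have "\<delta>\<^sup>2 \<le> H * ?E F" using attained by (metis power2_abs)
      also have "\<dots> < \<epsilon>\<^sup>2" using small H by (simp add: field_simps)
      finally have \<delta>\<epsilon>: "\<delta> \<le> \<epsilon>" using \<epsilon> by (meson less_eq_real_def power2_less_imp_less)

      have "norm (?M *v u) \<le> \<delta> / 4 * norm u" for u
      proof (rule power2_le_imp_le)
        have "(norm (?M *v u))\<^sup>2 = (\<Sum>b\<in>B. (\<mu> b)\<^sup>2 * (b \<bullet> u)\<^sup>2)"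
        proof -
          have "b \<bullet> (?M *v u) = \<mu> b * (b \<bullet> u)" if "b \<in> B" for b
          proof -
            have "b \<bullet> (?M *v u) = (?M *v b) \<bullet> u"
              by (simp add: inner_matrix_vector_mult adjoint_frame_defect)
            also have "\<dots> = (\<mu> b *\<^sub>R b) \<bullet> u" using eig[OF that] by (simp add: \<mu>_def)
            finally show ?thesis by simp
          qed
          then show ?thesis unfolding parseval[symmetric]
            by (intro sum.cong) (auto simp: power_mult_distrib)
        qed
        also have "\<dots> \<le> (\<Sum>b\<in>B. (\<delta> / 4)\<^sup>2 * (b \<bullet> u)\<^sup>2)"
        proof (intro sum_mono mult_right_mono)
          fix b assume "b \<in> B"
          then have "\<bar>\<mu> b\<bar> \<le> \<delta> / 4" using le by (auto simp: x_def)
          then show "(\<mu> b)\<^sup>2 \<le> (\<delta> / 4)\<^sup>2" by (metis abs_ge_zero power2_abs power_mono)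
        qed simp
        also have "\<dots> = (\<delta> / 4 * norm u)\<^sup>2"
          unfolding sum_distrib_left[symmetric] parseval power_mult_distrib ..
        finally show "(norm (?M *v u))\<^sup>2 \<le> (\<delta> / 4 * norm u)\<^sup>2" .
      qed (use \<delta>0 in simp)
      then have "(norm ?M)\<^sup>2 \<le> real CARD('d) * (\<delta> / 4)\<^sup>2" by (rule norm_squared_le_of_operator_bound)
      also have "\<dots> \<le> real CARD('d) * \<delta>\<^sup>2"
        using \<delta>0 by (intro mult_left_mono power_mono) auto
      finally have "(norm ?M)\<^sup>2 \<le> real CARD('d) * \<delta>\<^sup>2" .
      moreover have "1 / 4 * (\<Sum>i\<in>UNIV. (r $ i * ?\<nu> i)\<^sup>2) \<le> (\<Sum>i\<in>UNIV. (r $ i)\<^sup>2) * \<delta>\<^sup>2"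
      proof -
        have "(r $ i * ?\<nu> i)\<^sup>2 \<le> (r $ i)\<^sup>2 * \<delta>\<^sup>2" for i
          using le \<delta>0 unfolding power_mult_distrib y_def
          by (intro mult_left_mono) (auto simp: abs_le_square_iff[symmetric])
        then have "(\<Sum>i\<in>UNIV. (r $ i * ?\<nu> i)\<^sup>2) \<le> (\<Sum>i\<in>UNIV. (r $ i)\<^sup>2) * \<delta>\<^sup>2"
          unfolding sum_distrib_right by (rule sum_mono)
        moreover have "0 \<le> (\<Sum>i\<in>UNIV. (r $ i * ?\<nu> i)\<^sup>2)" by (simp add: sum_nonneg)
        ultimately show ?thesis by simp
      qed
      ultimately have EK: "?E F \<le> K * \<delta>\<^sup>2" by (simp add: E K_def distrib_right)

      show "?E F ^ 3 \<le> 4 * K ^ 3 / c\<^sup>2 * norm (energy_gradient r F) ^ 4"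
      proof (cases "\<delta> = 0")
        case True
        then have "?E F = 0" using EK total_frame_energy_nonneg[of r F] by simp
        then show ?thesis using K by simp
      next
        case False
        have "c * \<delta> ^ 3 \<le> (\<Sum>b\<in>B. \<Sum>i\<in>UNIV. p b i * (x b - y i)\<^sup>2)"
          by (rule cost[OF plan le attained]) (use False \<delta>0 \<delta>\<epsilon> in auto)
        also have "\<dots> = 2 * (norm (energy_gradient r F))\<^sup>2"
          using sum_spectral_weight_eq_norm_gradient[OF parseval, of F \<mu> r] eig
          by (simp add: p_def x_def y_def \<mu>_def)
        finally have "(c * \<delta> ^ 3)\<^sup>2 \<le> (2 * (norm (energy_gradient r F))\<^sup>2)\<^sup>2"
          using c \<delta>0 by (intro power_mono) auto
        then have *: "c\<^sup>2 * \<delta> ^ 6 \<le> 4 * norm (energy_gradient r F) ^ 4"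
          by (simp add: power_mult_distrib flip: power_mult)
        have "?E F ^ 3 \<le> (K * \<delta>\<^sup>2) ^ 3"
          by (intro power_mono EK total_frame_energy_nonneg)
        also have "\<dots> = K ^ 3 / c\<^sup>2 * (c\<^sup>2 * \<delta> ^ 6)"
          using c by (simp add: power_mult_distrib flip: power_mult)
        also have "\<dots> \<le> K ^ 3 / c\<^sup>2 * (4 * norm (energy_gradient r F) ^ 4)"
          using K by (intro mult_left_mono *) auto
        finally show ?thesis by (simp add: mult_ac)
      qed
    qed
  qed
qed

section \<open>Determinants and the greedy choice of columns\<close>

text \<open>
Liouville's formula. Differentiating the determinant replaces one row \<open>k\<close> at a time by the \<open>k\<close>-th row of
\<open>P G\<close>, a combination of the rows of \<open>G\<close>. Only the multiple \<open>P\<^sub>k\<^sub>k\<close> of the row itself survives; all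
others repeat a row.
\<close>

lemma has_vector_derivative_det:
  fixes G :: "real \<Rightarrow> complex^'d^'d"
  assumes "\<And>i j. ((\<lambda>s. G s $ i $ j) has_vector_derivative (P ** G t) $ i $ j) (at t within S)"
  shows "((\<lambda>s. det (G s)) has_vector_derivative trace P * det (G t)) (at t within S)"
proof -
  define R where "R p = (\<lambda>k. \<Prod>j\<in>UNIV - {k}. G t $ j $ p j)" for p
  have "((\<lambda>s. of_int (sign p) * (\<Prod>i\<in>UNIV. G s $ i $ p i)) has_vector_derivative
      of_int (sign p) * (\<Sum>k\<in>UNIV. (P ** G t) $ k $ p k * R p k)) (at t within S)" for p
  proof -
    have "((\<lambda>s. \<Prod>i\<in>UNIV. G s $ i $ p i) has_derivative
        (\<lambda>h. \<Sum>k\<in>UNIV. (h *\<^sub>R (P ** G t) $ k $ p k) * R p k)) (at t within S)"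
      unfolding R_def by (rule has_derivative_prod)
        (use assms in \<open>simp add: has_vector_derivative_def\<close>)
    then have "((\<lambda>s. \<Prod>i\<in>UNIV. G s $ i $ p i) has_vector_derivative
        (\<Sum>k\<in>UNIV. (P ** G t) $ k $ p k * R p k)) (at t within S)"
      by (simp add: has_vector_derivative_def scaleR_sum_right)
    then show ?thesis by (rule has_vector_derivative_mult_right)
  qed
  then have "((\<lambda>s. det (G s)) has_vector_derivative
      (\<Sum>p\<in>{p. p permutes UNIV}. of_int (sign p) * (\<Sum>k\<in>UNIV. (P ** G t) $ k $ p k * R p k)))
      (at t within S)"
    unfolding det_def by (intro has_vector_derivative_sum) auto
  moreover have "(\<Sum>p\<in>{p. p permutes UNIV}. of_int (sign p) * (\<Sum>k\<in>UNIV. (P ** G t) $ k $ p k * R p k))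
      = (\<Sum>k\<in>UNIV. det (\<chi> i. if i = k then row k (P ** G t) else row i (G t)))"
  proof -
    have "(P ** G t) $ k $ p k * R p k
        = (\<Prod>i\<in>UNIV. (\<chi> i. if i = k then row k (P ** G t) else row i (G t)) $ i $ p i)" for p k
      unfolding R_def by (subst prod.remove[of UNIV k]) (auto simp: row_def intro!: prod.cong)
    then show ?thesis
      unfolding det_def by (simp only: sum_distrib_left) (rule sum.swap)
  qed
  moreover have "det (\<chi> i. if i = k then row k (P ** G t) else row i (G t)) = P $ k $ k * det (G t)" for k
  proof -
    have row_k: "row k (P ** G t) = (\<Sum>l\<in>UNIV. P $ k $ l *s row l (G t))"
      by (simp add: vec_eq_iff row_def matrix_matrix_mult_def)
    have "det (\<chi> i. if i = k then row k (P ** G t) else row i (G t))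
        = (\<Sum>l\<in>UNIV. det (\<chi> i. if i = k then P $ k $ l *s row l (G t) else row i (G t)))"
      unfolding row_k by (rule det_linear_row_sum) simp
    also have "\<dots> = (\<Sum>l\<in>UNIV. P $ k $ l * det (\<chi> i. if i = k then row l (G t) else row i (G t)))"
      by (simp add: det_row_mul)
    also have "\<dots> = (\<Sum>l\<in>UNIV. if l = k then P $ k $ k * det (G t) else 0)"
    proof (rule sum.cong)
      fix l
      show "P $ k $ l * det (\<chi> i. if i = k then row l (G t) else row i (G t))
          = (if l = k then P $ k $ k * det (G t) else 0)"
      proof (cases "l = k")
        case True
        have "(\<chi> i. if i = k then row k (G t) else row i (G t)) = G t"
          by (simp add: vec_eq_iff row_def)
        then show ?thesis unfolding True by simp
      next
        case False
        have "det (\<chi> i. if i = k then row l (G t) else row i (G t)) = 0"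
          by (rule det_identical_rows[of k l]) (use False in \<open>auto simp: row_def vec_eq_iff\<close>)
        then show ?thesis using False by simp
      qed
    qed simp
    finally show ?thesis by simp
  qed
  ultimately show ?thesis
    by (simp add: trace_def sum_distrib_right)
qed

text \<open>
A weak form of Hadamard's inequality that can be read off Leibniz' formula. The factorial is harmless
because the estimates below are up to additive constants in the logarithm.
\<close>

lemma norm_det_le_prod_norm_columns:
  fixes G :: "complex^'d^'d"
  shows "norm (det G) \<le> fact CARD('d) * (\<Prod>j\<in>UNIV. norm (column j G))"
proof -
  have "norm (of_int (sign p) * (\<Prod>i\<in>UNIV. G $ i $ p i)) \<le> (\<Prod>j\<in>UNIV. norm (column j G))"
    if "p permutes UNIV" for p
  proof -
    have "norm (of_int (sign p) * (\<Prod>i\<in>UNIV. G $ i $ p i)) = (\<Prod>i\<in>UNIV. norm (G $ i $ p i))"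
      by (simp add: norm_mult prod_norm[symmetric] sign_def)
    also have "\<dots> \<le> (\<Prod>i\<in>UNIV. norm (column (p i) G))"
    proof (intro prod_mono conjI norm_ge_zero)
      fix i
      show "norm (G $ i $ p i) \<le> norm (column (p i) G)"
        using Finite_Cartesian_Product.norm_nth_le[of "column (p i) G" i] by (simp add: column_def)
    qed
    also have "\<dots> = (\<Prod>j\<in>UNIV. norm (column j G))"
      using prod.permute[OF that, of "\<lambda>j. norm (column j G)"] by (simp add: o_def)
    finally show ?thesis .
  qed
  then have "norm (det G) \<le> real (card {p :: 'd \<Rightarrow> 'd. p permutes UNIV}) * (\<Prod>j\<in>UNIV. norm (column j G))"
    unfolding det_def by (intro sum_norm_bound) auto
  then show ?thesis by (simp add: card_permutations[OF refl])
qed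

lemma smallest_values_subset:
  fixes b :: "'n::finite \<Rightarrow> real"
  assumes "m \<le> CARD('n)"
  shows "\<exists>R. card R = m \<and> (\<forall>i\<in>R. \<forall>j\<in>-R. b i \<le> b j)"
  using assms
proof (induction m)
  case 0
  then show ?case by (intro exI[of _ "{}"]) simp
next
  case (Suc m)
  then obtain R where R: "card R = m" "\<forall>i\<in>R. \<forall>j\<in>-R. b i \<le> b j" by auto
  have "- R \<noteq> {}"
  proof
    assume "- R = {}"
    then have "R = UNIV" by auto
    then show False using R Suc.prems by simp
  qed
  then have "Min (b ` (- R)) \<in> b ` (- R)" by (intro Min_in) auto
  then obtain k where k: "k \<notin> R" "b k = Min (b ` (- R))" by auto
  have "b k \<le> b j" if "j \<in> - R" for j unfolding k(2) using that by simp
  then show ?case using R k by (intro exI[of _ "insert k R"]) auto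
qed

text \<open>
Passing from the weight \<open>1\<close> on \<open>R\<close> to the weights \<open>r\<close> moves mass from values at most \<open>\<theta>\<close> to values at
least \<open>\<theta>\<close>, where \<open>\<theta>\<close> is the largest value on \<open>R\<close>.
\<close>

lemma weighted_sum_ge_sum_of_smallest:
  fixes b r :: "'n::finite \<Rightarrow> real"
  assumes R: "\<forall>i\<in>R. \<forall>j\<in>-R. b i \<le> b j" "R \<noteq> {}"
    and r: "\<And>i. 0 \<le> r i" "\<And>i. r i \<le> 1" "sum r UNIV = card R"
  shows "sum b R \<le> (\<Sum>i\<in>UNIV. r i * b i)"
proof -
  define \<theta> where "\<theta> = Max (b ` R)"
  have "\<theta> \<in> b ` R" unfolding \<theta>_def using R by (intro Max_in) auto
  then have out: "\<theta> \<le> b j" if "j \<notin> R" for j using R that by auto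
  have "(\<Sum>i\<in>UNIV. r i * b i) - sum b R = (\<Sum>i\<in>UNIV. (r i - of_bool (i \<in> R)) * b i)"
    by (simp add: left_diff_distrib sum_subtractf of_bool_def if_distrib[of "\<lambda>x. x * _"] sum.If_cases)
  also have "\<dots> \<ge> (\<Sum>i\<in>UNIV. (r i - of_bool (i \<in> R)) * \<theta>)"
  proof (rule sum_mono)
    fix i
    show "(r i - of_bool (i \<in> R)) * \<theta> \<le> (r i - of_bool (i \<in> R)) * b i"
    proof (cases "i \<in> R")
      case True
      then have "b i \<le> \<theta>" by (simp add: \<theta>_def)
      then show ?thesis using True r(2)[of i] by (simp add: mult_left_mono_neg)
    next
      case False
      then show ?thesis using out r(1)[of i] by (simp add: mult_left_mono)
    qed
  qed
  moreover have "(\<Sum>i\<in>UNIV. (r i - of_bool (i \<in> R)) * \<theta>) = 0"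
    using r(3) by (simp add: sum_distrib_right[symmetric] sum_subtractf of_bool_def sum.If_cases)
  ultimately show ?thesis by simp
qed

text \<open>
For \<open>D \<ge> 2\<close> this is the condition on the largest entry alone. For \<open>D = 1\<close> there is no such condition, but
positive numbers of sum \<open>1\<close> are at most \<open>1\<close>.
\<close>

lemma admissible_le_1:
  fixes r :: "real^'n"
  assumes adm: "admissible D r" and D: "1 \<le> D"
  shows "r $ i \<le> 1"
proof (cases "D = 1")
  case True
  have "r $ i \<le> (\<Sum>i\<in>UNIV. r $ i)"
    by (rule member_le_sum) (use adm in \<open>auto simp: admissible_def less_imp_le\<close>)
  then show ?thesis using adm True by (simp add: admissible_def)
next
  case False
  define xs where "xs = decreasing_rearrangement r"
  have "set xs = range (($) r)" by (simp add: xs_def decreasing_rearrangement_def)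
  then obtain k where k: "k < length xs" "xs ! k = r $ i"
    by (metis in_set_conv_nth rangeI)
  have "sorted (rev xs)" by (simp add: xs_def decreasing_rearrangement_def)
  then have "xs ! k \<le> xs ! 0" using k(1) by (simp add: sorted_rev_nth_mono)
  moreover have "xs ! 0 \<le> 1"
    using adm D False unfolding admissible_def xs_def by (auto dest!: bspec[of _ _ 1])
  ultimately show ?thesis using k(2) by simp
qed

section \<open>Functions on the half-line\<close>

lemma antiderivative_on_halfline:
  fixes g :: "real \<Rightarrow> real"
  assumes g: "continuous_on {0..} g" and t: "0 \<le> t"
  shows "((\<lambda>t. integral {0..t} g) has_real_derivative g t) (at t within {0..})"
proof -
  have "((\<lambda>t. integral {0..t} g) has_vector_derivative g t) (at t within {0..t+1})"
    by (rule integral_has_vector_derivative) (use assms in \<open>auto intro: continuous_on_subset\<close>)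
  moreover have "at t within {0..t+1} = at t within {0..}"
    by (rule at_within_nhd[of _ "{t-1<..<t+1}"]) auto
  ultimately show ?thesis
    by (simp add: has_real_derivative_iff_has_vector_derivative)
qed

lemma nonincreasing_on_halfline:
  fixes f :: "real \<Rightarrow> real"
  assumes f: "\<And>t. 0 \<le> t \<Longrightarrow> (f has_real_derivative f' t) (at t within {0..})"
    and neg: "\<And>t. 0 \<le> t \<Longrightarrow> f' t \<le> 0" and st: "0 \<le> s" "s \<le> t"
  shows "f t \<le> f s"
proof (rule DERIV_nonpos_imp_decreasing_open[OF st(2)])
  fix x assume "s < x" "x < t"
  then have "at x within {0..} = at x" using st by (intro at_within_interior) auto
  then show "\<exists>y. DERIV f x :> y \<and> y \<le> 0" using f[of x] neg[of x] st \<open>s < x\<close> by auto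
next
  have "continuous_on {0..} f"
    using f by (intro DERIV_continuous_on) auto
  then show "continuous_on {s..t} f" using st by (rule_tac continuous_on_subset) auto
qed

text \<open>
The values at the natural numbers form a Cauchy sequence; the tail bound carries its limit over to all real times.
\<close>

lemma convergent_at_top_of_tail_bound:
  fixes F :: "real \<Rightarrow> 'a::banach"
  assumes tail: "\<And>s t. T \<le> s \<Longrightarrow> s \<le> t \<Longrightarrow> norm (F t - F s) \<le> h s" and h: "(h \<longlongrightarrow> 0) at_top"
  shows "\<exists>L. (F \<longlongrightarrow> L) at_top"
proof -
  have "Cauchy (\<lambda>n. F (real n))"
  proof (rule CauchyI)
    fix e :: real assume "0 < e"
    then have "eventually (\<lambda>s. h s < e / 2 \<and> T \<le> s) at_top"
      by (intro eventually_conj order_tendstoD(2)[OF h] eventually_ge_at_top) simp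
    then obtain S where S: "\<And>s. S \<le> s \<Longrightarrow> h s < e / 2 \<and> T \<le> s"
      by (auto simp: eventually_at_top_linorder)
    obtain N :: nat where N: "S \<le> real N" using real_arch_simple by blast
    have "norm (F (real m) - F (real n)) < e" if "N \<le> m" "N \<le> n" for m n
    proof -
      have "norm (F (real m) - F (real N)) < e / 2" "norm (F (real n) - F (real N)) < e / 2"
        using tail[of "real N" "real m"] tail[of "real N" "real n"] S[OF N] that by force+
      then show ?thesis
        using norm_triangle_ineq4[of "F (real m) - F (real N)" "F (real n) - F (real N)"] by simp
    qed
    then show "\<exists>N. \<forall>m\<ge>N. \<forall>n\<ge>N. norm (F (real m) - F (real n)) < e" by blast
  qed
  then obtain L where L: "(\<lambda>n. F (real n)) \<longlonglongrightarrow> L"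
    using Cauchy_convergent convergent_def by blast
  have bound: "norm (L - F s) \<le> h s" if "T \<le> s" for s
  proof (rule tendsto_upperbound)
    show "(\<lambda>n. norm (F (real n) - F s)) \<longlonglongrightarrow> norm (L - F s)" by (intro tendsto_intros L)
    show "\<forall>\<^sub>F n in sequentially. norm (F (real n) - F s) \<le> h s"
      using eventually_ge_at_top[of "nat \<lceil>s\<rceil>"]
    proof eventually_elim
      case (elim n)
      then have "s \<le> real n" by linarith
      then show ?case using tail that by simp
    qed
  qed simp
  have "eventually (\<lambda>s. norm (F s - L) \<le> h s) at_top"
    using eventually_ge_at_top[of T] by eventually_elim (simp add: bound norm_minus_commute)
  then have "((\<lambda>s. F s - L) \<longlongrightarrow> 0) at_top"
    by (rule Lim_null_comparison[OF _ h])
  then show ?thesis using Lim_null by blast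
qed

section \<open>The flow of a full spark frame\<close>

text \<open>
The bounds on the entries of \<open>r\<close> and the value of their sum are what admissibility provides.
\<close>

locale frame_energy_flow =
  fixes r :: "real^'n" and F :: "real \<Rightarrow> complex^'n^'d"
  assumes r_pos: "\<And>i. 0 < r $ i" and r_le_1: "\<And>i. r $ i \<le> 1"
    and r_sum: "(\<Sum>i\<in>UNIV. r $ i) = real CARD('d)"
    and card_le: "CARD('d) \<le> CARD('n)"
    and spark: "full_spark (F 0)"
    and flow: "\<And>t. 0 \<le> t \<Longrightarrow>
      (F has_vector_derivative - energy_gradient r (F t)) (at t within {0..})"
begin

abbreviation energy :: "real \<Rightarrow> real" where
  "energy t \<equiv> total_frame_energy r (F t)"

lemma r_nonzero: "r $ i \<noteq> 0"
  using r_pos[of i] by simp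

lemma energy_eq:
  "total_frame_energy r X =
     (norm (frame_defect X))\<^sup>2 + 1 / 4 * (\<Sum>i\<in>UNIV. (r $ i * norm_defect r X i)\<^sup>2)"
  for X :: "complex^'n^'d"
  by (rule total_frame_energy_eq) (rule r_nonzero)

lemma continuous_flow: "continuous_on {0..} F"
  using flow by (intro continuous_on_vector_derivative) auto

lemma energy_derivative:
  assumes "0 \<le> t"
  shows "(energy has_real_derivative - (norm (energy_gradient r (F t)))\<^sup>2) (at t within {0..})"
proof -
  have "(energy has_derivative (\<lambda>h. (h *\<^sub>R - energy_gradient r (F t)) \<bullet> energy_gradient r (F t)))
      (at t within {0..})"
    using flow[OF assms] GDERIV_total_frame_energy[OF r_nonzero, of "F t"]
    unfolding has_vector_derivative_def gderiv_def by (rule has_derivative_compose)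
  then show ?thesis
    unfolding has_field_derivative_def
    by (rule has_derivative_eq_rhs) (simp add: fun_eq_iff power2_norm_eq_inner)
qed

lemma energy_nonincreasing: "0 \<le> s \<Longrightarrow> s \<le> t \<Longrightarrow> energy t \<le> energy s"
  by (rule nonincreasing_on_halfline[OF energy_derivative]) auto

lemma continuous_frame_defect: "continuous_on {0..} (\<lambda>t. frame_defect (F t))"
  unfolding frame_defect_def
  by (intro continuous_intros continuous_flow
      bounded_bilinear.continuous_on[OF bounded_bilinear_matrix_mult]
      bounded_linear.continuous_on[OF bounded_linear_adjoint_matrix])

lemma continuous_norm_defect: "continuous_on {0..} (\<lambda>t. norm_defect r (F t) i)"
  unfolding norm_defect_def divide_inverse
  by (intro continuous_intros continuous_flow bounded_linear.continuous_on[OF bounded_linear_column])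

text \<open>
The frame defect is Hermitian, so its trace is real and equals the real inner product with the identity.
\<close>

lemma trace_frame_defect: "trace (frame_defect X) = of_real (frame_defect X \<bullet> mat 1)"
  for X :: "complex^'n^'d"
proof -
  have "frame_defect X $ a $ a = of_real (Re (frame_defect X $ a $ a))" for a
  proof -
    have "cnj (frame_defect X $ a $ a) = adjoint_matrix (frame_defect X) $ a $ a"
      by (simp add: adjoint_matrix_def)
    then show ?thesis by (simp add: adjoint_frame_defect complex_eq_iff)
  qed
  then have "trace (frame_defect X) = (\<Sum>a\<in>UNIV. of_real (Re (frame_defect X $ a $ a)))"
    unfolding trace_def by (intro sum.cong) auto
  also have "\<dots> = of_real (\<Sum>a\<in>UNIV. Re (frame_defect X $ a $ a))" by simp
  also have "(\<Sum>a\<in>UNIV. Re (frame_defect X $ a $ a)) = frame_defect X \<bullet> mat 1"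
  proof -
    have "frame_defect X $ a $ b \<bullet> mat 1 $ a $ b = (if b = a then Re (frame_defect X $ a $ a) else 0)"
      for a b by (simp add: mat_def inner_complex_def)
    then show ?thesis by (simp add: inner_vec_def)
  qed
  finally show ?thesis .
qed

text \<open>
The logarithms \<open>y\<^sub>i\<close> of the column scalings and \<open>a\<close> of the determinant of the row operation that carry
\<open>F 0\<close> to \<open>F t\<close>. Defining them by their derivatives avoids solving the linear equation for the row
operation itself.
\<close>

definition column_log :: "'n \<Rightarrow> real \<Rightarrow> real" where
  "column_log i t = integral {0..t} (\<lambda>s. - norm_defect r (F s) i)"

definition det_log :: "real \<Rightarrow> real" where
  "det_log t = integral {0..t} (\<lambda>s. - 4 * (frame_defect (F s) \<bullet> mat 1))"

lemma column_log_0 [simp]: "column_log i 0 = 0" and det_log_0 [simp]: "det_log 0 = 0"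
  by (simp_all add: column_log_def det_log_def)

lemma column_log_derivative:
  "0 \<le> t \<Longrightarrow> (column_log i has_real_derivative - norm_defect r (F t) i) (at t within {0..})"
  unfolding column_log_def [abs_def]
  by (rule antiderivative_on_halfline) (auto intro!: continuous_intros continuous_norm_defect)

lemma det_log_derivative:
  "0 \<le> t \<Longrightarrow>
    (det_log has_real_derivative - 4 * (frame_defect (F t) \<bullet> mat 1)) (at t within {0..})"
  unfolding det_log_def [abs_def]
  by (rule antiderivative_on_halfline) (auto intro!: continuous_intros continuous_frame_defect)

text \<open>
Undoing the column scalings turns the flow into \<open>G' = - 4 M G\<close>, so by Liouville's formula
\<open>det G exp (- a)\<close> is constant. Its value is the minor of \<open>F 0\<close>, which full spark makes nonzero.
\<close>

lemma det_columns_bound: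
  assumes t: "0 \<le> t" and c: "inj c"
  shows "0 < norm (det (\<chi> k b. F 0 $ k $ c b))"
    and "norm (det (\<chi> k b. F 0 $ k $ c b)) * exp (det_log t)
      \<le> fact CARD('d) * (\<Prod>b\<in>UNIV. exp (- column_log (c b) t) * norm (column (c b) (F t)))"
proof -
  define G where "G t = (\<chi> k b. of_real (exp (- column_log (c b) t)) * F t $ k $ c b)" for t
  have G0: "G 0 = (\<chi> k b. F 0 $ k $ c b)" by (simp add: G_def)
  have "invertible (\<chi> k b. F 0 $ k $ c b)" using spark c by (simp add: full_spark_def)
  then show "0 < norm (det (\<chi> k b. F 0 $ k $ c b))" by (simp add: invertible_det_nz)
  have G': "((\<lambda>s. G s $ k $ b) has_vector_derivative ((-4 *\<^sub>R frame_defect (F s)) ** G s) $ k $ b)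
      (at s within {0..})" if s: "0 \<le> s" for s k b
  proof -
    let ?e = "of_real (exp (- column_log (c b) s)) :: complex"
    have F': "((\<lambda>s. F s $ k $ c b) has_vector_derivative - energy_gradient r (F s) $ k $ c b)
        (at s within {0..})"
      using bounded_linear.has_vector_derivative[OF bounded_linear_vec_nth
          bounded_linear.has_vector_derivative[OF bounded_linear_vec_nth flow[OF s]]] by simp
    have "((\<lambda>s. exp (- column_log (c b) s)) has_real_derivative exp (- column_log (c b) s) * norm_defect r (F s) (c b))
        (at s within {0..})"
      by (rule derivative_eq_intros column_log_derivative[OF s] refl)+ simp
    then have "((\<lambda>s. of_real (exp (- column_log (c b) s))) has_vector_derivative
        (of_real (exp (- column_log (c b) s) * norm_defect r (F s) (c b)) :: complex)) (at s within {0..})"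
      by (intro has_vector_derivative_of_real)
    from has_vector_derivative_mult[OF this F']
    have "((\<lambda>s. G s $ k $ b) has_vector_derivative
        ?e * (- energy_gradient r (F s) $ k $ c b)
        + of_real (exp (- column_log (c b) s) * norm_defect r (F s) (c b)) * F s $ k $ c b) (at s within {0..})"
      by (simp add: G_def)
    moreover have "((-4 *\<^sub>R frame_defect (F s)) ** G s) $ k $ b
        = - 4 * ?e * (frame_defect (F s) ** F s) $ k $ c b"
      by (simp add: matrix_matrix_mult_def G_def sum_distrib_left scaleR_conv_of_real[where 'a = complex] mult_ac)
    ultimately show ?thesis
      by (simp add: energy_gradient_def algebra_simps)
  qed
  have "((\<lambda>s. det (G s) * of_real (exp (- det_log s))) has_vector_derivative 0) (at s within {0..})"
    if s: "0 \<le> s" for s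
  proof -
    have "trace (-4 *\<^sub>R frame_defect (F s)) = of_real (-4 * (frame_defect (F s) \<bullet> mat 1))"
    proof -
      have "trace (c *\<^sub>R X) = c *\<^sub>R trace X" for c and X :: "complex^'d^'d"
        by (simp add: trace_def scaleR_sum_right)
      then show ?thesis by (simp only: trace_frame_defect scaleR_conv_of_real of_real_mult)
    qed
    then have D: "((\<lambda>s. det (G s)) has_vector_derivative
        of_real (-4 * (frame_defect (F s) \<bullet> mat 1)) * det (G s)) (at s within {0..})"
      using has_vector_derivative_det[of G "-4 *\<^sub>R frame_defect (F s)" s "{0..}", OF G'[OF s]] by simp
    have "((\<lambda>s. exp (- det_log s)) has_real_derivative exp (- det_log s) * (4 * (frame_defect (F s) \<bullet> mat 1)))
        (at s within {0..})"
      by (rule derivative_eq_intros det_log_derivative[OF s] refl)+ simp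
    then have "((\<lambda>s. of_real (exp (- det_log s))) has_vector_derivative
        (of_real (exp (- det_log s) * (4 * (frame_defect (F s) \<bullet> mat 1))) :: complex)) (at s within {0..})"
      by (intro has_vector_derivative_of_real)
    from has_vector_derivative_mult[OF D this] show ?thesis by (simp add: algebra_simps)
  qed
  then obtain z where z: "\<And>s. 0 \<le> s \<Longrightarrow> det (G s) * of_real (exp (- det_log s)) = z"
    using has_vector_derivative_zero_constant[of "{0..}" "\<lambda>s. det (G s) * of_real (exp (- det_log s))"]
    by auto
  have "det (G t) * of_real (exp (- det_log t)) = det (G 0)" using z[OF t] z[of 0] by simp
  then have "det (G 0) * of_real (exp (det_log t)) = det (G t) * of_real (exp (- det_log t) * exp (det_log t))"
    by (simp add: mult_ac)
  then have "det (G 0) * of_real (exp (det_log t)) = det (G t)"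
    by (simp flip: exp_add)
  then have "norm (det (G 0)) * exp (det_log t) = norm (det (G t))"
    by (metis norm_mult norm_of_real abs_of_pos exp_gt_zero)
  also have "\<dots> \<le> fact CARD('d) * (\<Prod>b\<in>UNIV. norm (column b (G t)))"
    by (rule norm_det_le_prod_norm_columns)
  also have "\<dots> = fact CARD('d) * (\<Prod>b\<in>UNIV. exp (- column_log (c b) t) * norm (column (c b) (F t)))"
  proof -
    have "column b (G t) = exp (- column_log (c b) t) *\<^sub>R column (c b) (F t)" for b
      by (simp add: column_def G_def vec_eq_iff scaleR_conv_of_real[where 'a = complex])
    then show ?thesis by simp
  qed
  finally show "norm (det (\<chi> k b. F 0 $ k $ c b)) * exp (det_log t)
      \<le> fact CARD('d) * (\<Prod>b\<in>UNIV. exp (- column_log (c b) t) * norm (column (c b) (F t)))"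
    unfolding G0 .
qed

text \<open>
The left-hand side is the derivative of the Kempf-Ness function along the flow: the three summands come
from \<open>|F|\<^sup>2 / 2\<close>, \<open>- a\<close> and \<open>- \<Sum>\<^sub>i r\<^sub>i y\<^sub>i\<close>. The terms that are linear in the defects cancel.
\<close>

lemma kempf_ness_derivative:
  fixes X :: "complex^'n^'d"
  shows "- (X \<bullet> energy_gradient r X) + 4 * (frame_defect X \<bullet> mat 1)
    + (\<Sum>i\<in>UNIV. r $ i * norm_defect r X i) = - 4 * total_frame_energy r X"
proof -
  let ?M = "frame_defect X" and ?\<nu> = "norm_defect r X"
  have "X \<bullet> (?M ** X) = ?M \<bullet> (X ** adjoint_matrix X)"
    using inner_matrix_mult_left[of ?M X X] by (simp add: inner_commute)
  also have "X ** adjoint_matrix X = ?M + mat 1" by (simp add: frame_defect_def)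
  finally have 1: "X \<bullet> (?M ** X) = (norm ?M)\<^sup>2 + ?M \<bullet> mat 1"
    by (simp add: inner_add_right power2_norm_eq_inner)
  have "?\<nu> i * (column i X \<bullet> column i X) = r $ i * ?\<nu> i + (r $ i * ?\<nu> i)\<^sup>2" for i
    using r_nonzero[of i]
    by (simp add: norm_defect_def power2_norm_eq_inner[symmetric] power2_eq_square field_simps)
  then have "(\<Sum>i\<in>UNIV. ?\<nu> i * (column i X \<bullet> column i X))
      = (\<Sum>i\<in>UNIV. r $ i * ?\<nu> i) + (\<Sum>i\<in>UNIV. (r $ i * ?\<nu> i)\<^sup>2)"
    by (simp add: sum.distrib)
  then show ?thesis unfolding inner_energy_gradient 1 energy_eq by simp
qed

text \<open>
At each time the bound on minors is used for the \<open>d\<close> columns with the smallest \<open>\<beta>\<^sub>i = ln |f\<^sub>i| - y\<^sub>i\<close>. Which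
columns these are changes with time, so the constant has to be uniform in the choice; there are only
finitely many choices.
\<close>

lemma kempf_ness_lower_bound:
  shows "\<exists>K. \<forall>t\<ge>0. K \<le> (norm (F t))\<^sup>2 / 2 - det_log t - (\<Sum>i\<in>UNIV. r $ i * column_log i t)"
proof -
  define minor where "minor c = norm (det (\<chi> k b. F 0 $ k $ c b))" for c
  have "finite ((\<lambda>c. ln (minor c)) ` (UNIV :: ('d \<Rightarrow> 'n) set))" by simp
  then obtain m where m: "\<And>c. m \<le> ln (minor c)"
    using bdd_below_finite unfolding bdd_below_def by (metis rangeI)
  define m' where "m' = m - ln (fact CARD('d))"
  have "m' \<le> (norm (F t))\<^sup>2 / 2 - det_log t - (\<Sum>i\<in>UNIV. r $ i * column_log i t)" if t: "0 \<le> t" for t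
  proof -
    let ?f = "\<lambda>i. norm (column i (F t))"
    have bound: "0 < minor c"
      "minor c * exp (det_log t) \<le> fact CARD('d) * (\<Prod>b\<in>UNIV. exp (- column_log (c b) t) * ?f (c b))"
      if "inj c" for c :: "'d \<Rightarrow> 'n"
      unfolding minor_def
      by (rule det_columns_bound[OF t that])+
    have subset: "\<exists>R (c :: 'd \<Rightarrow> 'n). R \<noteq> {} \<and> card R = CARD('d) \<and> inj c \<and> range c = R \<and> (\<forall>i\<in>R. \<forall>j\<in>-R. b i \<le> b j)"
      for b :: "'n \<Rightarrow> real"
    proof -
      obtain R where R: "card R = CARD('d)" "\<forall>i\<in>R. \<forall>j\<in>-R. b i \<le> b j"
        using smallest_values_subset[OF card_le] by blast
      obtain c where "bij_betw c (UNIV :: 'd set) R"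
        using finite_same_card_bij[of "UNIV :: 'd set" R] R(1) by auto
      then have "inj c" "range c = R" by (simp_all add: bij_betw_def)
      moreover have "R \<noteq> {}" using R(1) by auto
      ultimately show ?thesis
        by (intro exI[of _ R] exI[of _ c] conjI R)
    qed
    have f_pos: "0 < ?f i" for i
    proof -
      \<comment> \<open>Values that are smallest at \<open>i\<close> force \<open>i\<close> into \<open>R\<close>.\<close>
      obtain R and c :: "'d \<Rightarrow> 'n" where R: "R \<noteq> {}" "inj c" "range c = R"
        "\<forall>k\<in>R. \<forall>j\<in>-R. (of_bool (k \<noteq> i) :: real) \<le> of_bool (j \<noteq> i)"
        using subset[of "\<lambda>k. of_bool (k \<noteq> i)"] by (elim exE conjE) (rule that)
      have "i \<in> R"
      proof (rule ccontr)
        assume "i \<notin> R"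
        moreover obtain k where "k \<in> R" using R(1) by blast
        ultimately have "(of_bool (k \<noteq> i) :: real) \<le> of_bool (i \<noteq> i)" "k \<noteq> i" using R(4) by blast+
        then show False by simp
      qed
      then obtain b where b: "c b = i" using R(3) by auto
      have "0 < fact CARD('d) * (\<Prod>b\<in>UNIV. exp (- column_log (c b) t) * ?f (c b))"
        by (rule less_le_trans[OF _ bound(2)[OF R(2)]])
           (rule mult_pos_pos[OF bound(1)[OF R(2)] exp_gt_zero])
      then have "(\<Prod>b\<in>UNIV. exp (- column_log (c b) t) * ?f (c b)) \<noteq> 0"
        by (metis mult_zero_right less_irrefl)
      then have "?f (c b) \<noteq> 0" by (simp add: prod_zero_iff)
      then show ?thesis using b by simp
    qed
    define \<beta> where "\<beta> i = ln (?f i) - column_log i t" for i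
    obtain R and c :: "'d \<Rightarrow> 'n" where R: "R \<noteq> {}" "card R = CARD('d)" "inj c" "range c = R"
      "\<forall>i\<in>R. \<forall>j\<in>-R. \<beta> i \<le> \<beta> j"
      using subset[of \<beta>] by (elim exE conjE) (rule that)
    have "minor c * exp (det_log t) \<le> fact CARD('d) * (\<Prod>b\<in>UNIV. exp (\<beta> (c b)))"
      using bound(2)[OF R(3)] f_pos by (simp add: \<beta>_def exp_diff exp_minus field_simps)
    also have "\<dots> = fact CARD('d) * exp (sum \<beta> R)"
      using sum.reindex[OF R(3), of \<beta>] R(4) by (simp add: exp_sum)
    finally have "minor c * exp (det_log t) \<le> fact CARD('d) * exp (sum \<beta> R)" .
    then have "ln (minor c * exp (det_log t)) \<le> ln (fact CARD('d) * exp (sum \<beta> R))"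
      using bound(1)[OF R(3)] by (subst ln_le_cancel_iff) auto
    then have "ln (minor c) + det_log t \<le> ln (fact CARD('d)) + sum \<beta> R"
      using bound(1)[OF R(3)] by (simp add: ln_mult)
    then have "m' + det_log t \<le> sum \<beta> R" using m[of c] by (simp add: m'_def)
    also have "\<dots> \<le> (\<Sum>i\<in>UNIV. r $ i * \<beta> i)"
      by (rule weighted_sum_ge_sum_of_smallest)
        (use R r_pos r_le_1 r_sum in \<open>auto simp: less_imp_le\<close>)
    also have "\<dots> = (\<Sum>i\<in>UNIV. r $ i * ln (?f i)) - (\<Sum>i\<in>UNIV. r $ i * column_log i t)"
      by (simp add: \<beta>_def right_diff_distrib sum_subtractf)
    also have "(\<Sum>i\<in>UNIV. r $ i * ln (?f i)) \<le> (\<Sum>i\<in>UNIV. (?f i)\<^sup>2 / 2)"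
    proof (rule sum_mono)
      fix i
      have "ln (?f i) \<le> ?f i - 1" using f_pos[of i] ln_le_minus_one by blast
      also have "\<dots> \<le> (?f i)\<^sup>2 / 2"
      proof -
        have "0 \<le> (?f i - 1)\<^sup>2 + 1" by simp
        then show ?thesis by (simp add: power2_diff)
      qed
      finally have "ln (?f i) \<le> (?f i)\<^sup>2 / 2" .
      then have "r $ i * ln (?f i) \<le> r $ i * ((?f i)\<^sup>2 / 2)"
        using r_pos[of i] by (intro mult_left_mono) auto
      also have "\<dots> \<le> 1 * ((?f i)\<^sup>2 / 2)"
        using r_le_1[of i] by (intro mult_right_mono) auto
      finally show "r $ i * ln (?f i) \<le> (?f i)\<^sup>2 / 2" by simp
    qed
    also have "\<dots> = (norm (F t))\<^sup>2 / 2"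
      by (simp add: sum_norm_column_sq[symmetric] sum_divide_distrib)
    finally show ?thesis by linarith
  qed
  then show ?thesis by blast
qed

text \<open>
Since \<open>\<psi>' = - 4 E\<close> and \<open>E' \<le> 0\<close>, the function \<open>\<psi> + 4 t E\<close> is nonincreasing, so a lower bound on \<open>\<psi>\<close> yields
\<open>E \<le> const / t\<close>.
\<close>

lemma energy_tendsto_0: "(energy \<longlongrightarrow> 0) at_top"
proof -
  define \<psi> where "\<psi> t = (norm (F t))\<^sup>2 / 2 - det_log t - (\<Sum>i\<in>UNIV. r $ i * column_log i t)" for t
  obtain K where K: "\<And>t. 0 \<le> t \<Longrightarrow> K \<le> \<psi> t"
    using kempf_ness_lower_bound unfolding \<psi>_def by blast
  have \<psi>': "(\<psi> has_real_derivative - 4 * energy t) (at t within {0..})" if t: "0 \<le> t" for t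
  proof -
    have "((\<lambda>t. F t \<bullet> F t) has_derivative
        (\<lambda>h. F t \<bullet> (h *\<^sub>R - energy_gradient r (F t)) + (h *\<^sub>R - energy_gradient r (F t)) \<bullet> F t))
        (at t within {0..})"
      using flow[OF t] unfolding has_vector_derivative_def by (intro has_derivative_inner)
    then have "((\<lambda>t. F t \<bullet> F t) has_real_derivative - 2 * (F t \<bullet> energy_gradient r (F t)))
        (at t within {0..})"
      unfolding has_field_derivative_def
      by (rule has_derivative_eq_rhs) (auto simp: fun_eq_iff inner_commute)
    then have "((\<lambda>t. (F t \<bullet> F t) / 2 - det_log t - (\<Sum>i\<in>UNIV. r $ i * column_log i t)) has_real_derivative
        - 2 * (F t \<bullet> energy_gradient r (F t)) / 2 - (- 4 * (frame_defect (F t) \<bullet> mat 1))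
        - (\<Sum>i\<in>UNIV. r $ i * - norm_defect r (F t) i)) (at t within {0..})"
      by (intro DERIV_diff DERIV_cdivide DERIV_sum DERIV_cmult det_log_derivative column_log_derivative t)
    moreover have "- 2 * (F t \<bullet> energy_gradient r (F t)) / 2 - (- 4 * (frame_defect (F t) \<bullet> mat 1))
        - (\<Sum>i\<in>UNIV. r $ i * - norm_defect r (F t) i) = - 4 * energy t"
      using kempf_ness_derivative[of "F t"] by (simp add: sum_negf)
    ultimately show ?thesis by (simp only: \<psi>_def [abs_def] power2_norm_eq_inner)
  qed
  have bound: "energy t \<le> (\<psi> 0 - K) / 4 / t" if t: "0 < t" for t
  proof -
    have "((\<lambda>t. \<psi> t + 4 * (t * energy t)) has_real_derivative
        - 4 * (s * (norm (energy_gradient r (F s)))\<^sup>2)) (at s within {0..})" if s: "0 \<le> s" for s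
      by (rule derivative_eq_intros \<psi>'[OF s] energy_derivative[OF s] refl)+ (simp add: algebra_simps)
    from nonincreasing_on_halfline[OF this, of 0 t] have "\<psi> t + 4 * (t * energy t) \<le> \<psi> 0"
      using t by simp
    then have "4 * (t * energy t) \<le> \<psi> 0 - K" using K[of t] t by simp
    then show ?thesis using t by (simp add: field_simps)
  qed
  have lim: "((\<lambda>t. (\<psi> 0 - K) / 4 / t) \<longlongrightarrow> 0) at_top"
    by (rule tendsto_divide_0[OF tendsto_const filterlim_at_top_imp_at_infinity[OF filterlim_ident]])
  show ?thesis
  proof (rule tendsto_sandwich[OF _ _ tendsto_const lim])
    show "eventually (\<lambda>t. 0 \<le> energy t) at_top" by (simp add: total_frame_energy_nonneg)
    show "eventually (\<lambda>t. energy t \<le> (\<psi> 0 - K) / 4 / t) at_top"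
      using eventually_gt_at_top[of 0] by eventually_elim (rule bound)
  qed
qed

lemma energy_eq_0_iff:
  "total_frame_energy r X = 0 \<longleftrightarrow> frame_defect X = 0 \<and> (\<forall>i. norm_defect r X i = 0)"
  for X :: "complex^'n^'d"
  unfolding energy_eq using r_nonzero
  by (subst add_nonneg_eq_0_iff) (auto simp: sum_nonneg_eq_0_iff intro!: sum_nonneg)

text \<open>
If the energy vanishes at some time, the flow has stopped. Otherwise \<open>E powr (1/4)\<close> is differentiable, and
by the Lojasiewicz inequality its rate of decrease dominates the speed of the flow, so the distance still
to be travelled is bounded by a multiple of \<open>E powr (1/4)\<close>.
\<close>

lemma flow_converges: "\<exists>L. (F \<longlongrightarrow> L) at_top"
proof (cases "\<exists>t0\<ge>0. energy t0 = 0")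
  case True
  then obtain t0 where t0: "0 \<le> t0" "energy t0 = 0" by blast
  have "(F has_vector_derivative 0) (at t within {t0..})" if "t \<in> {t0..}" for t
  proof -
    have t: "t0 \<le> t" using that by simp
    have "energy t = 0"
      using energy_nonincreasing[OF t0(1) t] t0(2) total_frame_energy_nonneg[of r "F t"] by simp
    then have "energy_gradient r (F t) = 0"
      by (simp add: energy_eq_0_iff energy_gradient_def vec_eq_iff matrix_matrix_mult_def)
    then show ?thesis
      using has_vector_derivative_within_subset[OF flow[of t], of "{t0..}"] t0 t by simp
  qed
  then obtain L where "\<And>t. t \<in> {t0..} \<Longrightarrow> F t = L"
    by (rule has_vector_derivative_zero_constant[rotated]) auto
  then have "eventually (\<lambda>t. F t = L) at_top"
    by (intro eventually_mono[OF eventually_ge_at_top[of t0]]) auto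
  then show ?thesis using tendsto_eventually by blast
next
  case False
  then have pos: "0 < energy t" if "0 \<le> t" for t
    using that total_frame_energy_nonneg[of r "F t"] by (metis less_eq_real_def)
  obtain \<epsilon> C where \<epsilon>: "0 < \<epsilon>" and C: "\<And>X :: complex^'n^'d. total_frame_energy r X < \<epsilon> \<Longrightarrow>
      total_frame_energy r X ^ 3 \<le> C * norm (energy_gradient r X) ^ 4"
    using total_frame_energy_Lojasiewicz[of r, OF r_pos] by blast
  have "eventually (\<lambda>t. energy t < \<epsilon>) at_top" using energy_tendsto_0 \<epsilon> by (rule order_tendstoD)
  then obtain T0 where T0: "\<And>t. T0 \<le> t \<Longrightarrow> energy t < \<epsilon>" by (auto simp: eventually_at_top_linorder)
  define T where "T = max 0 T0"
  define k where "k = max 1 C"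
  have k: "1 \<le> k" by (simp add: k_def)
  have grad: "energy t powr (3/4) \<le> k * norm (energy_gradient r (F t))" if "T \<le> t" for t
  proof (rule power_le_imp_le_base)
    have "(energy t powr (3/4)) ^ Suc 3 = energy t ^ 3"
      using pos[of t] that by (simp add: powr_power T_def)
    also have "\<dots> \<le> C * norm (energy_gradient r (F t)) ^ 4"
      using T0[of t] that C[of "F t"] by (simp add: T_def)
    also have "\<dots> \<le> k ^ 4 * norm (energy_gradient r (F t)) ^ 4"
      using k power_increasing[of 1 4 k] by (intro mult_right_mono) (auto simp: k_def)
    finally show "(energy t powr (3/4)) ^ Suc 3 \<le> (k * norm (energy_gradient r (F t))) ^ Suc 3"
      by (simp add: power_mult_distrib)
  qed (use k in simp)
  define \<phi> where "\<phi> t = - 4 * k * energy t powr (1/4)" for t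
  have at: "at t within {0..} = at t" if "0 < t" for t :: real
    using that by (intro at_within_interior) auto
  have \<phi>': "(\<phi> has_real_derivative k * energy t powr (-3/4) * (norm (energy_gradient r (F t)))\<^sup>2)
      (at t within {0..})" if t: "0 \<le> t" for t
  proof -
    have "((\<lambda>t. - 4 * k * energy t powr (1/4)) has_real_derivative
        - 4 * k * (1/4 * energy t powr (1/4 - 1) * - (norm (energy_gradient r (F t)))\<^sup>2)) (at t within {0..})"
      by (intro DERIV_cmult DERIV_chain2[OF has_real_derivative_powr[OF pos[OF t]] energy_derivative[OF t]])
    moreover have "- 4 * k * (1/4 * energy t powr (1/4 - 1) * - (norm (energy_gradient r (F t)))\<^sup>2)
        = k * energy t powr (-3/4) * (norm (energy_gradient r (F t)))\<^sup>2"
      by simp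
    ultimately show ?thesis by (simp only: \<phi>_def [abs_def])
  qed
  have tail: "norm (F t - F s) \<le> 4 * k * energy s powr (1/4)" if s: "T \<le> s" and "s \<le> t" for s t
  proof (cases "s = t")
    case True then show ?thesis using k by simp
  next
    case False
    have s0: "0 \<le> s" using s by (simp add: T_def)
    have "norm (F t - F s) \<le> \<phi> t - \<phi> s"
    proof (rule differentiable_bound_general[where f' = "\<lambda>t. - energy_gradient r (F t)"
          and \<phi>' = "\<lambda>t. k * energy t powr (-3/4) * (norm (energy_gradient r (F t)))\<^sup>2"])
      show "s < t" using False that by simp
      show "continuous_on {s..t} F" using s0 by (intro continuous_on_subset[OF continuous_flow]) auto
      have "continuous_on {0..} \<phi>" using \<phi>' by (intro DERIV_continuous_on) auto
      then show "continuous_on {s..t} \<phi>" using s0 by (rule_tac continuous_on_subset) auto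
      fix u assume u: "s < u" "u < t"
      then have u0: "0 < u" and uT: "T \<le> u" using s0 s by auto
      show "(F has_vector_derivative - energy_gradient r (F u)) (at u)" using flow[of u] at[OF u0] u0 by simp
      show "(\<phi> has_vector_derivative k * energy u powr (-3/4) * (norm (energy_gradient r (F u)))\<^sup>2) (at u)"
        using \<phi>'[of u] at[OF u0] u0 by (simp add: has_real_derivative_iff_has_vector_derivative)
      let ?g = "norm (energy_gradient r (F u))"
      have "energy u powr (-3/4) * energy u powr (3/4) = 1"
        using pos[of u] u0 by (simp flip: powr_add)
      then have "?g = energy u powr (-3/4) * energy u powr (3/4) * ?g" by simp
      also have "\<dots> \<le> energy u powr (-3/4) * (k * ?g) * ?g"
        by (intro mult_right_mono mult_left_mono grad uT) auto
      finally show "norm (- energy_gradient r (F u)) \<le> k * energy u powr (-3/4) * ?g\<^sup>2"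
        by (simp add: power2_eq_square mult_ac)
    qed
    also have "\<dots> \<le> 4 * k * energy s powr (1/4)" using k by (simp add: \<phi>_def)
    finally show ?thesis .
  qed
  have "((\<lambda>s. 4 * k * energy s powr (1/4)) \<longlongrightarrow> 4 * k * 0 powr (1/4)) at_top"
    by (intro tendsto_mult tendsto_const tendsto_powr' energy_tendsto_0)
       (auto simp: total_frame_energy_nonneg)
  then have "((\<lambda>s. 4 * k * energy s powr (1/4)) \<longlongrightarrow> 0) at_top" by simp
  from convergent_at_top_of_tail_bound[OF tail this] show ?thesis .
qed

lemma flow_converges_to_parseval_frame: "\<exists>L\<in>parseval_frames r. (F \<longlongrightarrow> L) at_top"
proof -
  obtain L where L: "(F \<longlongrightarrow> L) at_top" using flow_converges by blast
  have "isCont (total_frame_energy r) L"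
    using GDERIV_total_frame_energy[OF r_nonzero, of L] unfolding gderiv_def
    by (rule has_derivative_continuous)
  then have "(energy \<longlongrightarrow> total_frame_energy r L) at_top"
    using L by (rule isCont_tendsto_compose)
  then have "total_frame_energy r L = 0"
    using energy_tendsto_0 by (rule tendsto_unique[rotated]) simp
  then have "frame_defect L = 0" "\<And>i. norm_defect r L i = 0" by (auto simp: energy_eq_0_iff)
  then have "L \<in> parseval_frames r"
    using r_nonzero by (auto simp: parseval_frames_def frame_defect_def norm_defect_def)
  then show ?thesis using L by blast
qed

end

section \<open>From complex to real frames\<close>

definition complexify :: "real^'n^'d \<Rightarrow> complex^'n^'d" where
  "complexify F = (\<chi> a i. of_real (F $ a $ i))"

lemma column_complexify_norm: "norm (column i (complexify F)) = norm (column i F)"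
  by (simp add: column_def complexify_def norm_vec_def)

lemma complexify_Gram:
  "complexify F ** adjoint_matrix (complexify F) - mat 1 = complexify (F ** adjoint_matrix F - mat 1)"
  by (simp add: complexify_def vec_eq_iff matrix_matrix_mult_def adjoint_matrix_def mat_def)

lemma norm_complexify: "norm (complexify F) = norm F"
  by (simp add: complexify_def norm_vec_def)

lemma bounded_linear_complexify: "bounded_linear complexify"
  by (intro linear_conv_bounded_linear[THEN iffD1] linearI)
     (simp_all add: complexify_def vec_eq_iff scaleR_conv_of_real[where 'a = complex])

lemma total_frame_energy_complexify: "total_frame_energy r (complexify F) = total_frame_energy r F"
  unfolding total_frame_energy_def complexify_Gram norm_complexify column_complexify_norm ..

lemma complexify_gradient:
  fixes F :: "real^'n^'d"
  assumes "\<And>i. r $ i \<noteq> 0"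
  shows "complexify (gradient (total_frame_energy r) F) = energy_gradient r (complexify F)"
proof -
  define D :: "real^'n^'d" where "D = (\<chi> a i. 4 * ((F ** adjoint_matrix F - mat 1) ** F) $ a $ i
    + norm_defect r (complexify F) i * F $ a $ i)"
  have D: "complexify D = energy_gradient r (complexify F)"
    unfolding energy_gradient_def frame_defect_def complexify_Gram
    by (simp add: D_def complexify_def vec_eq_iff matrix_matrix_mult_def)
  have "((\<lambda>F. total_frame_energy r (complexify F)) has_derivative
      (\<lambda>h. complexify h \<bullet> energy_gradient r (complexify F))) (at F)"
    using GDERIV_total_frame_energy[OF assms, of "complexify F"] unfolding gderiv_def
    by (rule has_derivative_compose[rotated])
       (rule bounded_linear.has_derivative[OF bounded_linear_complexify has_derivative_ident])
  moreover have "complexify X \<bullet> complexify Y = X \<bullet> Y" for X Y :: "real^'n^'d"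
    by (simp add: complexify_def inner_vec_def inner_complex_def)
  ultimately have "GDERIV (total_frame_energy r) F :> D"
    by (simp add: gderiv_def D[symmetric] total_frame_energy_complexify)
  then show ?thesis by (simp add: gradient_eqI D)
qed

lemma complexify_gradient_flow:
  fixes \<Gamma> :: "real \<Rightarrow> real^'n^'d"
  assumes "\<And>i. r $ i \<noteq> 0"
    and "(\<Gamma> has_vector_derivative - gradient (total_frame_energy r) (\<Gamma> t)) (at t within S)"
  shows "((\<lambda>t. complexify (\<Gamma> t)) has_vector_derivative - energy_gradient r (complexify (\<Gamma> t))) (at t within S)"
  using bounded_linear.has_vector_derivative[OF bounded_linear_complexify assms(2)]
  by (simp add: complexify_gradient[OF assms(1)] linear_neg[OF bounded_linear.linear[OF bounded_linear_complexify]])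

lemma full_spark_complexify:
  fixes F :: "real^'n^'d"
  assumes "full_spark F"
  shows "full_spark (complexify F)"
  unfolding full_spark_def
proof (intro allI impI)
  fix c :: "'d \<Rightarrow> 'n" assume "inj c"
  then obtain B where B: "(\<chi> i j. F $ i $ c j) ** B = mat 1" "B ** (\<chi> i j. F $ i $ c j) = mat 1"
    using assms unfolding full_spark_def invertible_def by blast
  have mult: "complexify (X ** Y) = complexify X ** complexify Y" for X Y :: "real^'d^'d"
    by (simp add: complexify_def matrix_matrix_mult_def vec_eq_iff)
  have one: "complexify (mat 1 :: real^'d^'d) = mat 1"
    by (simp add: complexify_def mat_def vec_eq_iff)
  have sub: "(\<chi> i j. complexify F $ i $ c j) = complexify (\<chi> i j. F $ i $ c j)"
    by (simp add: complexify_def vec_eq_iff)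
  show "invertible (\<chi> i j. complexify F $ i $ c j)"
    unfolding sub invertible_def using B by (metis mult one)
qed

lemma complexify_limit:
  fixes f :: "real \<Rightarrow> real^'n^'d"
  assumes "((\<lambda>t. complexify (f t)) \<longlongrightarrow> L) at_top"
  shows "\<exists>X. L = complexify X \<and> (f \<longlongrightarrow> X) at_top"
proof -
  define X where "X = (\<chi> a i. Re (L $ a $ i))"
  have "((\<lambda>t. \<chi> a i. Re (complexify (f t) $ a $ i)) \<longlongrightarrow> X) at_top"
    unfolding X_def by (intro tendsto_vec_lambda tendsto_Re tendsto_vec_nth assms)
  then have X: "(f \<longlongrightarrow> X) at_top" by (simp add: complexify_def)
  from bounded_linear.tendsto[OF bounded_linear_complexify X] assms
  have "L = complexify X" by (intro tendsto_unique[of at_top]) auto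
  then show ?thesis using X by blast
qed

lemma complexify_in_parseval_frames_iff:
  fixes X :: "real^'n^'d"
  shows "complexify X \<in> parseval_frames r \<longleftrightarrow> X \<in> parseval_frames r"
proof -
  have "complexify Y = 0 \<longleftrightarrow> Y = 0" for Y :: "real^'d^'d"
    using norm_complexify[of Y] by (metis norm_eq_zero)
  then show ?thesis
    using complexify_Gram[of X] by (simp add: parseval_frames_def column_complexify_norm)
      (metis right_minus_eq)
qed

theorem theorem2p8:
  fixes r :: "real^'n"
  assumes "CARD('d::finite) \<le> CARD('n)"
    and "\<And>i. r $ i \<in> \<rat> \<and> 0 < r $ i"
    and "admissible CARD('d) r"
  shows
    "(\<forall>(\<Gamma> :: real^'n^'d \<Rightarrow> real \<Rightarrow> real^'n^'d) F\<^sub>0.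
        is_negative_gradient_flow (total_frame_energy r) \<Gamma> \<longrightarrow> full_spark F\<^sub>0 \<longrightarrow>
        (\<exists>F\<in>parseval_frames r. (\<Gamma> F\<^sub>0 \<longlongrightarrow> F) at_top)) \<and>
     (\<forall>(\<Gamma> :: complex^'n^'d \<Rightarrow> real \<Rightarrow> complex^'n^'d) F\<^sub>0.
        is_negative_gradient_flow (total_frame_energy r) \<Gamma> \<longrightarrow> full_spark F\<^sub>0 \<longrightarrow>
        (\<exists>F\<in>parseval_frames r. (\<Gamma> F\<^sub>0 \<longlongrightarrow> F) at_top))"
proof -
  have r: "0 < r $ i" "r $ i \<noteq> 0" "r $ i \<le> 1" for i
    using assms(2)[of i] admissible_le_1[OF assms(3)] by auto
  have sum: "(\<Sum>i\<in>UNIV. r $ i) = real CARD('d)" using assms(3) by (simp add: admissible_def)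
  show ?thesis
  proof (intro conjI allI impI)
    fix \<Gamma> :: "complex^'n^'d \<Rightarrow> real \<Rightarrow> complex^'n^'d" and F\<^sub>0 :: "complex^'n^'d"
    assume flow: "is_negative_gradient_flow (total_frame_energy r) \<Gamma>" and spark: "full_spark F\<^sub>0"
    have grad: "gradient (total_frame_energy r) X = energy_gradient r X" for X :: "complex^'n^'d"
      by (rule gradient_eqI[OF GDERIV_total_frame_energy]) (rule r)
    interpret frame_energy_flow r "\<Gamma> F\<^sub>0"
      by unfold_locales (use flow spark grad r sum assms(1) in \<open>auto simp: is_negative_gradient_flow_def\<close>)
    show "\<exists>F\<in>parseval_frames r. (\<Gamma> F\<^sub>0 \<longlongrightarrow> F) at_top"
      by (rule flow_converges_to_parseval_frame)
  next
    fix \<Gamma> :: "real^'n^'d \<Rightarrow> real \<Rightarrow> real^'n^'d" and F\<^sub>0 :: "real^'n^'d"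
    assume flow: "is_negative_gradient_flow (total_frame_energy r) \<Gamma>" and spark: "full_spark F\<^sub>0"
    interpret frame_energy_flow r "\<lambda>t. complexify (\<Gamma> F\<^sub>0 t)"
      by unfold_locales
        (use flow spark r sum assms(1) in \<open>auto simp: is_negative_gradient_flow_def
          intro!: full_spark_complexify complexify_gradient_flow\<close>)
    obtain L where L: "L \<in> parseval_frames r" "((\<lambda>t. complexify (\<Gamma> F\<^sub>0 t)) \<longlongrightarrow> L) at_top"
      using flow_converges_to_parseval_frame by blast
    then show "\<exists>F\<in>parseval_frames r. (\<Gamma> F\<^sub>0 \<longlongrightarrow> F) at_top"
      using complexify_limit[OF L(2)] complexify_in_parseval_frames_iff by blast
  qed
qed

end
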